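(* Let $n\ge1$ and $Z=(z_1,\ldots,z_n)\in\mathbb{D}^n$. The matrix at $Z$ of the pulled-back metric $\pi_n^*g_n$ in the coordinates $z_1,\ldots,z_n$ is $$G_Z=\left[\frac{1}{(1-\overline{z_i}z_j)^2}\right]_{i,j=1}^n .$$ If $f\colon\mathbb{D}\to\mathbb{D}$ is holomorphic and $F_f\colon\mathbb{G}_n\to\mathbb{G}_n$ is the induced map, then the matrix at $Z$ of $\pi_n^*(F_f^*g_n)$ in the coordinates $z_1,\ldots,z_n$ is $$H_{f,Z}=\left[\frac{\overline{f'(z_i)}f'(z_j)}{(1-\overline{f(z_i)}f(z_j))^2}\right]_{i,j=1}^n .$$
   Context: $\mathbb{D}$ is the open unit disk in $\mathbb{C}$. Let $\pi_n(Z)=(\sigma_1(Z),\ldots,\sigma_n(Z))$, where $\sigma_k(Z)=\sum_{1\le i_1<\cdots<i_k\le n}z_{i_1}\cdots z_{i_k}$ is the $k$th elementary symmetric polynomial. The symmetrized polydisc is $\mathbb{G}_n=\pi_n(\mathbb{D}^n)$, a domain in $\mathbb{C}^n$. Let $S_n$ be the Szegő kernel of $\mathbb{G}_n$; it is the function on $\mathbb{G}_n\times\mathbb{G}_n$, holomorphic in the first and antiholomorphic in the second variable, determined by $$S_n(\pi_n(Z),\pi_n(W))=\prod_{i,j=1}^n\frac{1}{1-z_i\overline{w_j}},\qquad Z,W\in\mathbb{D}^n$$ (this known formula may be taken as the definition of $S_n$). The Hermitian metric $g_n$ on $\mathbb{G}_n$ has, in the coordinates $u=(u_1,\ldots,u_n)\in\mathbb{G}_n$,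 the matrix $$[g_n(u)]_{\alpha\beta}=\frac{\partial^2}{\partial u_\beta\,\partial\overline{u_\alpha}}\log S_n(u,u),$$ so that $v\in\mathbb{C}^n$ has squared length $v^*g_n(u)v$ at $u$. For a holomorphic map $\varphi$ with complex Jacobian matrix $D\varphi$, the pullback $\varphi^*g$ of a Hermitian form $g$ is the Hermitian form (possibly degenerate) with matrix $D\varphi(x)^*\,g(\varphi(x))\,D\varphi(x)$ at $x$. A holomorphic $f\colon\mathbb{D}\to\mathbb{D}$ induces a well-defined holomorphic map $F_f\colon\mathbb{G}_n\to\mathbb{G}_n$ by $F_f(\pi_n(z_1,\ldots,z_n))=\pi_n(f(z_1),\ldots,f(z_n))$. *)

theory Defs
  imports "HOL-Complex_Analysis.Complex_Analysis"
begin

(* the same symbol is also used for vec_nth *)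
no_notation fps_nth (infixl "$" 75)

text \<open>
  Points of $n$-dimensional complex space are of type \<open>complex ^ 'n\<close>, where \<open>'n\<close> is an arbitrary
  finite linearly ordered type and $n$ is its cardinality. The order is only used to number the
  coordinates \<open>1, \<dots>, n\<close>: \<open>index i\<close> is the position of \<open>i\<close> in the order.
\<close>

definition index :: "'n::{finite,linorder} \<Rightarrow> nat" where
  "index i = card {..i}"

definition esym :: "nat \<Rightarrow> complex ^ 'n \<Rightarrow> complex" where
  "esym k Z = (\<Sum>I | card I = k. \<Prod>i\<in>I. Z $ i)"

definition symmetrization :: "complex ^ 'n::{finite,linorder} \<Rightarrow> complex ^ 'n::{finite,linorder}" where
  "symmetrization Z = (\<chi> k. esym (index k) Z)"

definition polydisc :: "(complex ^ 'n) set" where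
  "polydisc = {Z. \<forall>i. Z $ i \<in> ball 0 1}"

definition symmetrized_polydisc :: "(complex ^ 'n::{finite,linorder}) set" where
  "symmetrized_polydisc = symmetrization ` polydisc"

text \<open>
  The two definite descriptions below are legitimate on the symmetrized polydisc, where the value
  does not depend on the chosen preimages; see \<open>szego_kernel_symmetrization\<close> and
  \<open>induced_map_symmetrization\<close>. Outside of it the values are unspecified.
\<close>

definition szego_kernel ::
    "complex ^ 'n::{finite,linorder} \<Rightarrow> complex ^ 'n::{finite,linorder} \<Rightarrow> complex" where
  "szego_kernel u w = (THE s. \<exists>Z\<in>polydisc. \<exists>W\<in>polydisc.
     symmetrization Z = u \<and> symmetrization W = w \<and>
     s = (\<Prod>i\<in>UNIV. \<Prod>j\<in>UNIV. 1 / (1 - Z $ i * cnj (W $ j))))"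

definition induced_map ::
    "(complex \<Rightarrow> complex) \<Rightarrow> complex ^ 'n::{finite,linorder} \<Rightarrow> complex ^ 'n::{finite,linorder}" where
  "induced_map f u =
     (THE w. \<exists>Z\<in>polydisc. symmetrization Z = u \<and> w = symmetrization (\<chi> i. f (Z $ i)))"

text \<open>
  The Wirtinger derivatives $\partial/\partial u_k = (\partial/\partial x_k - i\,\partial/\partial y_k)/2$
  and $\partial/\partial\overline{u_k} = (\partial/\partial x_k + i\,\partial/\partial y_k)/2$,
  where $u_k = x_k + i y_k$. The real partial derivatives are the values of the real Frechet
  derivative at the vectors with $k$-th entry $1$ and $i$, respectively.
\<close>

definition wirtinger ::
    "'n \<Rightarrow> (complex ^ 'n \<Rightarrow> complex) \<Rightarrow> complex ^ 'n \<Rightarrow> complex" where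
  "wirtinger k h u =
     (frechet_derivative h (at u) (axis k 1) - \<i> * frechet_derivative h (at u) (axis k \<i>)) / 2"

definition wirtinger_bar ::
    "'n \<Rightarrow> (complex ^ 'n \<Rightarrow> complex) \<Rightarrow> complex ^ 'n \<Rightarrow> complex" where
  "wirtinger_bar k h u =
     (frechet_derivative h (at u) (axis k 1) + \<i> * frechet_derivative h (at u) (axis k \<i>)) / 2"

text \<open>
  The logarithm is the complex one, principal branch; the kernel is positive on the diagonal of the
  symmetrized polydisc.
\<close>

definition szego_metric ::
    "complex ^ 'n::{finite,linorder} \<Rightarrow> complex ^ 'n::{finite,linorder} ^ 'n::{finite,linorder}" where
  "szego_metric u =
     (\<chi> \<alpha> \<beta>. wirtinger \<beta> (wirtinger_bar \<alpha> (\<lambda>v. ln (szego_kernel v v))) u)"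

definition conjugate_transpose :: "complex ^ 'n ^ 'm \<Rightarrow> complex ^ 'm ^ 'n" where
  "conjugate_transpose A = transpose (map_matrix cnj A)"

text \<open>
  The library's \<open>jacobian\<close> of a map between complex spaces has the entries
  \<open>frechet_derivative \<phi> (at x) (axis j 1) $ i\<close>, so for holomorphic \<open>\<phi>\<close> it is the complex Jacobian.
\<close>

definition pullback_form ::
    "(complex ^ 'n \<Rightarrow> complex ^ 'm) \<Rightarrow> (complex ^ 'm \<Rightarrow> complex ^ 'm ^ 'm) \<Rightarrow>
     complex ^ 'n \<Rightarrow> complex ^ 'n ^ 'n" where
  "pullback_form \<phi> g x =
     conjugate_transpose (jacobian \<phi> (at x)) ** g (\<phi> x) ** jacobian \<phi> (at x)"


lemma index_surj:
  assumes "1 \<le> k" "k \<le> CARD('n::{finite,linorder})"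
  shows "\<exists>i::'n. index i = k"
proof -
  have inj: "inj (index :: 'n \<Rightarrow> nat)"
  proof (rule linorder_injI)
    fix x y :: 'n assume "x < y"
    then have "{..x} \<subset> {..y}" by auto
    then have "index x < index y" unfolding index_def by (intro psubset_card_mono) auto
    then show "index x \<noteq> index y" by simp
  qed
  have sub: "range (index :: 'n \<Rightarrow> nat) \<subseteq> {1..CARD('n)}"
  proof -
    have "card {..x} \<ge> 1" for x :: 'n
      using card_gt_0_iff[of "{..x}"] by (auto simp: Suc_le_eq)
    then show ?thesis by (auto simp: index_def intro!: card_mono)
  qed
  have "range (index :: 'n \<Rightarrow> nat) = {1..CARD('n)}"
    by (rule card_subset_eq) (use sub inj in \<open>auto simp: card_image\<close>)
  with assms show ?thesis
    by (metis atLeastAtMost_iff imageE)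
qed

lemma prod_linear_factors_esym:
  "(\<Prod>i\<in>UNIV. [:Z $ i, 1:]) =
     (\<Sum>k\<le>CARD('n). [:esym k (Z :: complex ^ 'n):] * [:0, 1:] ^ (CARD('n) - k))"
proof -
  have "(\<Prod>i\<in>UNIV. [:Z $ i, 1:]) = (\<Prod>i\<in>UNIV. [:Z $ i:] + [:0, 1:])"
    by simp
  also have "\<dots> = (\<Sum>I\<in>Pow UNIV. (\<Prod>i\<in>I. [:Z $ i:]) * (\<Prod>i\<in>UNIV - I. [:0, 1:]))"
    by (rule prod_add) auto
  also have "\<dots> = (\<Sum>I\<in>UNIV. [:\<Prod>i\<in>I. Z $ i:] * [:0, 1:] ^ (CARD('n) - card I))"
  proof -
    have "(\<Prod>i\<in>I. [:Z $ i:]) = [:\<Prod>i\<in>I. Z $ i:]" for I :: "'n set"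
      by (induction I rule: infinite_finite_induct) auto
    then show ?thesis
      by (simp add: card_Diff_subset)
  qed
  also have "\<dots> = (\<Sum>k\<le>CARD('n). \<Sum>I | I \<in> UNIV \<and> card I = k.
      [:\<Prod>i\<in>I. Z $ i:] * [:0, 1:] ^ (CARD('n) - card I))"
    by (rule sum.group[symmetric]) (auto intro: card_mono)
  also have "\<dots> = (\<Sum>k\<le>CARD('n). [:esym k Z:] * [:0, 1:] ^ (CARD('n) - k))"
  proof (rule sum.cong[OF refl])
    fix k
    have "[:esym k Z:] = (\<Sum>I | card I = k. [:\<Prod>i\<in>I. Z $ i:])"
    proof -
      have "[:sum h A:] = (\<Sum>I\<in>A. [:h I:])" for h :: "'n set \<Rightarrow> complex" and A
        by (induction A rule: infinite_finite_induct) (simp_all, metis add.right_neutral add_pCons)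
      then show ?thesis by (simp add: esym_def)
    qed
    then show "(\<Sum>I | I \<in> UNIV \<and> card I = k. [:\<Prod>i\<in>I. Z $ i:] * [:0, 1:] ^ (CARD('n) - card I)) =
        [:esym k Z:] * [:0, 1:] ^ (CARD('n) - k)"
      by (simp only: sum_distrib_right) (rule sum.cong, auto)
  qed
  finally show ?thesis .
qed

lemma symmetrization_eq_imp_mset_eq:
  fixes Z W :: "complex ^ 'n::{finite,linorder}"
  assumes "symmetrization Z = symmetrization W"
  shows "image_mset (($) Z) (mset_set UNIV) = image_mset (($) W) (mset_set UNIV)"
proof -
  have "esym k Z = esym k W" if k: "k \<le> CARD('n)" for k
  proof (cases "k = 0")
    case True
    then show ?thesis by (simp add: esym_def)
  next
    case False
    then have "1 \<le> k" by simp
    then obtain i :: 'n where "index i = k"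
      using index_surj[where 'n = 'n, OF _ k] by blast
    then show ?thesis
      using assms by (auto simp: symmetrization_def vec_eq_iff)
  qed
  then have eq: "(\<Prod>i\<in>UNIV. [:Z $ i, 1:]) = (\<Prod>i\<in>UNIV. [:W $ i, 1:])"
    unfolding prod_linear_factors_esym by simp
  have roots: "proots (\<Prod>i\<in>UNIV. [:V $ i, 1:]) = image_mset (\<lambda>i. - V $ i) (mset_set UNIV)"
    for V :: "complex ^ 'n::{finite,linorder}"
  proof -
    have "proots (\<Prod>i\<in>UNIV. [:V $ i, 1:]) = (\<Sum>i\<in>UNIV. {#- V $ i#})"
      by (subst proots_prod) auto
    also have "\<dots> = image_mset (\<lambda>i. - V $ i) (mset_set UNIV)"
    proof -
      have "(\<Sum>i\<in>A. {#- V $ i#}) = image_mset (\<lambda>i. - V $ i) (mset_set A)" if "finite A" for A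
        using that by induction auto
      then show ?thesis by simp
    qed
    finally show ?thesis .
  qed
  have "image_mset uminus (proots (\<Prod>i\<in>UNIV. [:Z $ i, 1:])) =
        image_mset uminus (proots (\<Prod>i\<in>UNIV. [:W $ i, 1:]))"
    using eq by simp
  then show ?thesis
    unfolding roots by (simp add: multiset.map_comp o_def)
qed

lemma prod_eq_prod_mset_coords:
  "(\<Prod>i\<in>UNIV. h (Z $ i)) = prod_mset (image_mset h (image_mset (($) Z) (mset_set UNIV)))"
  for Z :: "complex ^ 'n" and h :: "complex \<Rightarrow> 'b::comm_monoid_mult"
  by (simp add: multiset.map_comp o_def prod_unfold_prod_mset)

lemma szego_kernel_symmetrization:
  fixes Z W :: "complex ^ 'n::{finite,linorder}"
  assumes "Z \<in> polydisc" "W \<in> polydisc"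
  shows "szego_kernel (symmetrization Z) (symmetrization W) =
    (\<Prod>i\<in>UNIV. \<Prod>j\<in>UNIV. 1 / (1 - Z $ i * cnj (W $ j)))"
  unfolding szego_kernel_def
proof (rule the_equality)
  show "\<exists>Z'\<in>polydisc. \<exists>W'\<in>polydisc. symmetrization Z' = symmetrization Z \<and>
      symmetrization W' = symmetrization W \<and>
      (\<Prod>i\<in>UNIV. \<Prod>j\<in>UNIV. 1 / (1 - Z $ i * cnj (W $ j))) =
      (\<Prod>i\<in>UNIV. \<Prod>j\<in>UNIV. 1 / (1 - Z' $ i * cnj (W' $ j)))"
    using assms by blast
next
  fix s
  assume "\<exists>Z'\<in>polydisc. \<exists>W'\<in>polydisc. symmetrization Z' = symmetrization Z \<and>
      symmetrization W' = symmetrization W \<and>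
      s = (\<Prod>i\<in>UNIV. \<Prod>j\<in>UNIV. 1 / (1 - Z' $ i * cnj (W' $ j)))"
  then obtain Z' W' where *: "symmetrization Z' = symmetrization Z"
      "symmetrization W' = symmetrization W"
      "s = (\<Prod>i\<in>UNIV. \<Prod>j\<in>UNIV. 1 / (1 - Z' $ i * cnj (W' $ j)))"
    by blast
  have "s = (\<Prod>i\<in>UNIV. \<Prod>j\<in>UNIV. 1 / (1 - Z' $ i * cnj (W $ j)))"
    unfolding *(3)
  proof (rule prod.cong[OF refl])
    fix i
    show "(\<Prod>j\<in>UNIV. 1 / (1 - Z' $ i * cnj (W' $ j))) = (\<Prod>j\<in>UNIV. 1 / (1 - Z' $ i * cnj (W $ j)))"
      using prod_eq_prod_mset_coords[of "\<lambda>w. 1 / (1 - Z' $ i * cnj w)" W']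
        prod_eq_prod_mset_coords[of "\<lambda>w. 1 / (1 - Z' $ i * cnj w)" W]
        symmetrization_eq_imp_mset_eq[OF *(2)] by simp
  qed
  also have "\<dots> = (\<Prod>i\<in>UNIV. \<Prod>j\<in>UNIV. 1 / (1 - Z $ i * cnj (W $ j)))"
    using prod_eq_prod_mset_coords[of "\<lambda>z. \<Prod>j\<in>UNIV. 1 / (1 - z * cnj (W $ j))" Z']
      prod_eq_prod_mset_coords[of "\<lambda>z. \<Prod>j\<in>UNIV. 1 / (1 - z * cnj (W $ j))" Z]
      symmetrization_eq_imp_mset_eq[OF *(1)] by simp
  finally show "s = (\<Prod>i\<in>UNIV. \<Prod>j\<in>UNIV. 1 / (1 - Z $ i * cnj (W $ j)))" .
qed

lemma esym_cong_mset:
  fixes Z W :: "complex ^ 'n"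
  assumes "image_mset (($) Z) (mset_set UNIV) = image_mset (($) W) (mset_set UNIV)"
    and "k \<le> CARD('n)"
  shows "esym k Z = esym k W"
proof -
  have coeff: "coeff (\<Prod>i\<in>UNIV. [:V $ i, 1:]) (CARD('n) - k) = esym k V" for V :: "complex ^ 'n"
  proof -
    have "coeff (\<Prod>i\<in>UNIV. [:V $ i, 1:]) (CARD('n) - k) =
        (\<Sum>l\<le>CARD('n). if l = k then esym l V else 0)"
      unfolding prod_linear_factors_esym coeff_sum
      by (intro sum.cong)
        (use assms(2) in \<open>auto simp: coeff_linear_power monom_altdef[of 1, simplified, symmetric]\<close>)
    then show ?thesis using assms(2) by simp
  qed
  have "(\<Prod>i\<in>UNIV. [:Z $ i, 1:]) = (\<Prod>i\<in>UNIV. [:W $ i, 1:])"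
    using prod_eq_prod_mset_coords[of "\<lambda>z. [:z, 1:]" Z]
      prod_eq_prod_mset_coords[of "\<lambda>z. [:z, 1:]" W] assms(1) by simp
  then show ?thesis using coeff by metis
qed

lemma induced_map_symmetrization:
  fixes Z :: "complex ^ 'n::{finite,linorder}"
  assumes "Z \<in> polydisc"
  shows "induced_map f (symmetrization Z) = symmetrization (\<chi> i. f (Z $ i))"
  unfolding induced_map_def
proof (rule the_equality)
  show "\<exists>Z'\<in>polydisc. symmetrization Z' = symmetrization Z \<and>
      symmetrization (\<chi> i. f (Z $ i)) = symmetrization (\<chi> i. f (Z' $ i))"
    using assms by blast
next
  fix w
  assume "\<exists>Z'\<in>polydisc. symmetrization Z' = symmetrization Z \<and>
      w = symmetrization (\<chi> i. f (Z' $ i))"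
  then obtain Z' where *: "symmetrization Z' = symmetrization Z"
      "w = symmetrization (\<chi> i. f (Z' $ i))" by blast
  have "image_mset (($) (\<chi> i. f (Z' $ i))) (mset_set UNIV) =
        image_mset (($) (\<chi> i. f (Z $ i))) (mset_set UNIV)"
    using arg_cong[OF symmetrization_eq_imp_mset_eq[OF *(1)], of "image_mset f"]
    by (simp add: multiset.map_comp o_def cong: image_mset_cong)
  moreover have "index k \<le> CARD('n)" for k :: 'n
    by (auto simp: index_def intro: card_mono)
  ultimately show "w = symmetrization (\<chi> i. f (Z $ i))"
    unfolding *(2) by (auto simp: symmetrization_def vec_eq_iff intro: esym_cong_mset)
qed

end

theory Submission
  imports Defs "HOL-Computational_Algebra.Fundamental_Theorem_Algebra"
begin

text \<open>
  On the polydisc, \<open>ln (szego_kernel u u)\<close> with \<open>u = symmetrization Z\<close> is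
  \<open>- (\<Sum>i j. Ln (1 - Z $ i * cnj (Z $ j)))\<close>, whose mixed second derivatives are the claimed entries. Since
  the symmetrization is holomorphic, the chain rule moves them to the metric as soon as the
  logarithm of the kernel is known to be smooth in \<open>u\<close>. At points with coinciding coordinates, where
  the symmetrization has no local inverse, this smoothness comes from writing the reciprocal of the
  kernel as a determinant that is a polynomial in \<open>u\<close> and its conjugate: with the companion matrix
  \<open>C\<close> of the polynomial with roots \<open>Z $ i\<close>, the product of the values \<open>q (Z $ i)\<close> is \<open>det (q C)\<close>.

  The induced map is treated at a single point \<open>symmetrization Z\<close>. Interpolating \<open>f\<close> by a polynomial
  \<open>p\<close> to second order at all \<open>Z $ i\<close> leaves a remainder divisible by the square of
  \<open>\<Prod>i. t - Z $ i\<close>. At the roots belonging to a nearby \<open>u\<close> that product is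
  \<open>O(norm (u - symmetrization Z))\<close>, so the maps induced by \<open>f\<close> and \<open>p\<close> differ by a quadratic error
  and have the same derivative there; the map induced by \<open>p\<close> is polynomial.
\<close>

subsection \<open>Wirtinger derivatives\<close>

text \<open>
  \<open>a\<close> and \<open>b\<close> are the families of derivatives with respect to the coordinates and their conjugates, so
  \<open>b = (\<lambda>k. 0)\<close> expresses complex differentiability at \<open>x\<close>.
\<close>

definition has_wirtinger ::
    "(complex ^ 'n \<Rightarrow> complex) \<Rightarrow> ('n \<Rightarrow> complex) \<Rightarrow> ('n \<Rightarrow> complex) \<Rightarrow> complex ^ 'n \<Rightarrow> bool" where
  "has_wirtinger h a b x \<longleftrightarrow>
     (h has_derivative (\<lambda>t. \<Sum>k\<in>UNIV. a k * t $ k + b k * cnj (t $ k))) (at x)"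

text \<open>Evaluating the derivative at \<open>axis k 1\<close> and \<open>axis k \<i>\<close>
  separates the two families, so they are unique. Identities between derivatives are later obtained
  by computing the families of one function in two ways.\<close>

lemma has_wirtinger_imp_wirtinger:
  fixes h :: "complex ^ 'n \<Rightarrow> complex"
  assumes "has_wirtinger h a b x"
  shows "wirtinger k h x = a k" "wirtinger_bar k h x = b k"
proof -
  have fd: "frechet_derivative h (at x) = (\<lambda>t. \<Sum>k\<in>UNIV. a k * t $ k + b k * cnj (t $ k))"
    using frechet_derivative_at[OF assms[unfolded has_wirtinger_def]] by simp
  have 1: "frechet_derivative h (at x) (axis k c) = a k * c + b k * cnj c" for c
  proof -
    have "(\<Sum>l\<in>UNIV. a l * axis k c $ l + b l * cnj (axis k c $ l)) =
      (\<Sum>l\<in>UNIV. if l = k then a k * c + b k * cnj c else 0)"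
      by (rule sum.cong) (auto simp: axis_def)
    then show ?thesis by (simp add: fd)
  qed
  show "wirtinger k h x = a k" "wirtinger_bar k h x = b k"
    by (simp_all add: wirtinger_def wirtinger_bar_def 1 field_simps)
qed

lemma has_wirtinger_imp_differentiable:
  "has_wirtinger h a b x \<Longrightarrow> h differentiable (at x)"
  unfolding has_wirtinger_def differentiable_def by blast

lemma has_wirtinger_transform:
  assumes "has_wirtinger h a b x" "open S" "x \<in> S" "\<And>y. y \<in> S \<Longrightarrow> h y = g y"
  shows "has_wirtinger g a b x"
  using has_derivative_transform_within_open[OF assms(1)[unfolded has_wirtinger_def] assms(2-4)]
  unfolding has_wirtinger_def by simp

lemma has_wirtinger_eq_rhs:
  "has_wirtinger h a b x \<Longrightarrow> (\<And>k. a k = a' k) \<Longrightarrow> (\<And>k. b k = b' k) \<Longrightarrow> has_wirtinger h a' b' x"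
  unfolding has_wirtinger_def by simp

lemma has_wirtinger_const: "has_wirtinger (\<lambda>x. c) (\<lambda>k. 0) (\<lambda>k. 0) x"
  unfolding has_wirtinger_def by simp

lemma has_wirtinger_coord:
  "has_wirtinger (\<lambda>x. x $ k) (\<lambda>l. if l = k then 1 else 0) (\<lambda>l. 0) x"
proof -
  have "((\<lambda>x::complex^'a. x $ k) has_derivative (\<lambda>t. t $ k)) (at x)"
    by (rule bounded_linear_imp_has_derivative[OF bounded_linear_vec_nth])
  moreover have "(\<lambda>t::complex^'a. t $ k) = (\<lambda>t. \<Sum>l\<in>UNIV. (if l = k then 1 else 0) * t $ l + 0 * cnj (t $ l))"
    by (simp add: if_distrib[where f="\<lambda>x. x * _"] cong: if_cong)
  ultimately show ?thesis unfolding has_wirtinger_def by metis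
qed

lemma has_wirtinger_cnj:
  assumes "has_wirtinger h a b x"
  shows "has_wirtinger (\<lambda>x. cnj (h x)) (\<lambda>k. cnj (b k)) (\<lambda>k. cnj (a k)) x"
  using bounded_linear.has_derivative[OF bounded_linear_cnj assms[unfolded has_wirtinger_def]]
  unfolding has_wirtinger_def by (simp add: cnj_sum add.commute)

lemma has_wirtinger_add:
  assumes "has_wirtinger f a b x" "has_wirtinger g c d x"
  shows "has_wirtinger (\<lambda>x. f x + g x) (\<lambda>k. a k + c k) (\<lambda>k. b k + d k) x"
  unfolding has_wirtinger_def
  by (rule has_derivative_eq_rhs[OF has_derivative_add[OF assms[unfolded has_wirtinger_def]]])
     (simp only: sum.distrib[symmetric], simp add: algebra_simps)

lemma has_wirtinger_mult:
  assumes "has_wirtinger f a b x" "has_wirtinger g c d x"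
  shows "has_wirtinger (\<lambda>x. f x * g x) (\<lambda>k. f x * c k + a k * g x) (\<lambda>k. f x * d k + b k * g x) x"
  unfolding has_wirtinger_def
  by (rule has_derivative_eq_rhs[OF has_derivative_mult[OF assms[unfolded has_wirtinger_def]]])
     (simp only: sum.distrib[symmetric] sum_distrib_left sum_distrib_right, simp add: algebra_simps)

lemma has_wirtinger_sum:
  assumes "\<And>i. i \<in> I \<Longrightarrow> has_wirtinger (f i) (a i) (b i) x"
  shows "has_wirtinger (\<lambda>x. \<Sum>i\<in>I. f i x) (\<lambda>k. \<Sum>i\<in>I. a i k) (\<lambda>k. \<Sum>i\<in>I. b i k) x"
  using assms
  by (induction I rule: infinite_finite_induct) (auto simp: has_wirtinger_const intro!: has_wirtinger_add)

lemma has_wirtinger_DERIV: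
  assumes "has_wirtinger h a b x" "(g has_field_derivative d) (at (h x))"
  shows "has_wirtinger (\<lambda>x. g (h x)) (\<lambda>k. d * a k) (\<lambda>k. d * b k) x"
  unfolding has_wirtinger_def
  by (rule has_derivative_eq_rhs[OF has_derivative_compose[OF assms(1)[unfolded has_wirtinger_def]
        assms(2)[unfolded has_field_derivative_def]]])
     (simp only: sum_distrib_left, simp add: algebra_simps)

lemma vec_derivative_if_components_wirtinger:
  fixes \<phi> :: "complex ^ 'n \<Rightarrow> complex ^ 'm"
  assumes "\<And>k. has_wirtinger (\<lambda>x. \<phi> x $ k) (J k) (\<lambda>i. 0) x"
  shows "(\<phi> has_derivative (\<lambda>t. (\<chi> k i. J k i) *v t)) (at x)"
proof -
  have "((\<lambda>x. \<chi> k. \<phi> x $ k) has_derivative (\<lambda>t. \<chi> k. \<Sum>i\<in>UNIV. J k i * t $ i)) (at x)"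
    using assms unfolding has_wirtinger_def
    by (subst has_derivative_componentwise_within)
      (auto simp: Basis_vec_def inner_axis intro!: has_derivative_inner_left)
  then show ?thesis by (simp add: matrix_vector_mult_def)
qed

lemma jacobian_if_components_wirtinger:
  fixes \<phi> :: "complex ^ 'n \<Rightarrow> complex ^ 'm"
  assumes "\<And>k. has_wirtinger (\<lambda>x. \<phi> x $ k) (J k) (\<lambda>i. 0) x"
  shows "jacobian \<phi> (at x) = (\<chi> k i. J k i)"
  using frechet_derivative_at[OF vec_derivative_if_components_wirtinger[OF assms]]
  unfolding jacobian_def by (metis matrix_of_matrix_vector_mul)

text \<open>The derivative of the inner map is multiplication by the complex matrix
  \<open>J\<close>, so substituting it pairs \<open>a\<close> with \<open>J\<close> and
  \<open>b\<close> with the conjugate of \<open>J\<close>.\<close>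

lemma has_wirtinger_compose:
  fixes \<phi> :: "complex ^ 'n \<Rightarrow> complex ^ 'm"
  assumes h: "has_wirtinger h a b (\<phi> x)"
    and \<phi>: "\<And>k. has_wirtinger (\<lambda>x. \<phi> x $ k) (J k) (\<lambda>i. 0) x"
  shows "has_wirtinger (\<lambda>x. h (\<phi> x)) (\<lambda>i. \<Sum>k\<in>UNIV. a k * J k i) (\<lambda>i. \<Sum>k\<in>UNIV. b k * cnj (J k i)) x"
  unfolding has_wirtinger_def
proof (rule has_derivative_eq_rhs[OF has_derivative_compose[OF
        vec_derivative_if_components_wirtinger[OF \<phi>] h[unfolded has_wirtinger_def]]], rule ext)
  fix t
  show "(\<Sum>k\<in>UNIV. a k * ((\<chi> k i. J k i) *v t) $ k + b k * cnj (((\<chi> k i. J k i) *v t) $ k)) =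
    (\<Sum>i\<in>UNIV. (\<Sum>k\<in>UNIV. a k * J k i) * t $ i + (\<Sum>k\<in>UNIV. b k * cnj (J k i)) * cnj (t $ i))"
  proof -
    have "(\<Sum>k\<in>UNIV. a k * (\<Sum>i\<in>UNIV. J k i * t $ i)) = (\<Sum>i\<in>UNIV. (\<Sum>k\<in>UNIV. a k * J k i) * t $ i)"
      unfolding sum_distrib_left sum_distrib_right mult.assoc by (rule sum.swap)
    moreover have "(\<Sum>k\<in>UNIV. b k * cnj (\<Sum>i\<in>UNIV. J k i * t $ i)) =
        (\<Sum>i\<in>UNIV. (\<Sum>k\<in>UNIV. b k * cnj (J k i)) * cnj (t $ i))"
      unfolding sum_distrib_left sum_distrib_right mult.assoc cnj_sum complex_cnj_mult by (rule sum.swap)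
    ultimately show ?thesis by (simp add: matrix_vector_mult_def sum.distrib)
  qed
qed

text \<open>A real-linear map is determined by its values at \<open>axis k 1\<close> and
  \<open>axis k \<i>\<close>, which regroup into coefficients of \<open>t $ k\<close> and its
  conjugate. Real differentiability therefore suffices to use the chain rule with the derivatives
  occurring in the metric.\<close>

lemma has_wirtinger_if_differentiable:
  fixes h :: "complex ^ 'n \<Rightarrow> complex"
  assumes "h differentiable (at x)"
  shows "has_wirtinger h (\<lambda>k. wirtinger k h x) (\<lambda>k. wirtinger_bar k h x) x"
proof -
  let ?D = "frechet_derivative h (at x)"
  have D: "(h has_derivative ?D) (at x)" using assms frechet_derivative_works by blast
  then interpret D: bounded_linear ?D by (rule has_derivative_bounded_linear)
  have "?D t = (\<Sum>k\<in>UNIV. wirtinger k h x * t $ k + wirtinger_bar k h x * cnj (t $ k))" for t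
  proof -
    have "t = (\<Sum>k\<in>UNIV. Re (t $ k) *\<^sub>R axis k 1 + Im (t $ k) *\<^sub>R axis k \<i>)"
      by (simp add: vec_eq_iff axis_def if_distrib[where f="scaleR _"] if_distrib[where f="(+) _"] complex_eq_iff
         sum.distrib cong: if_cong)
    then have "?D t = ?D (\<Sum>k\<in>UNIV. Re (t $ k) *\<^sub>R axis k 1 + Im (t $ k) *\<^sub>R axis k \<i>)"
      by simp
    also have "\<dots> = (\<Sum>k\<in>UNIV. Re (t $ k) *\<^sub>R ?D (axis k 1) + Im (t $ k) *\<^sub>R ?D (axis k \<i>))"
      by (simp add: D.sum D.add D.scaleR)
    also have "\<dots> = (\<Sum>k\<in>UNIV. wirtinger k h x * t $ k + wirtinger_bar k h x * cnj (t $ k))"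
      by (rule sum.cong) (auto simp: wirtinger_def wirtinger_bar_def complex_eq_iff field_simps)
    finally show ?thesis .
  qed
  then show ?thesis using D unfolding has_wirtinger_def by (metis (no_types, lifting) has_derivative_eq_rhs ext)
qed

subsection \<open>Polynomial functions\<close>

text \<open>The algebra of functions generated by \<open>B\<close>. Over \<open>coords\<close> it
  consists of the holomorphic polynomials, over \<open>coords_cnj\<close> of the polynomials in the
  coordinates and their conjugates.\<close>

inductive polyfun :: "('a \<Rightarrow> complex) set \<Rightarrow> ('a \<Rightarrow> complex) \<Rightarrow> bool" for B where
  polyfun_const: "polyfun B (\<lambda>x. c)"
| polyfun_base: "f \<in> B \<Longrightarrow> polyfun B f"
| polyfun_add: "polyfun B f \<Longrightarrow> polyfun B g \<Longrightarrow> polyfun B (\<lambda>x. f x + g x)"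
| polyfun_mult: "polyfun B f \<Longrightarrow> polyfun B g \<Longrightarrow> polyfun B (\<lambda>x. f x * g x)"

lemma polyfun_sum: "(\<And>i. i \<in> I \<Longrightarrow> polyfun B (f i)) \<Longrightarrow> polyfun B (\<lambda>x. \<Sum>i\<in>I. f i x)"
  by (induction I rule: infinite_finite_induct) (auto intro: polyfun_const polyfun_add)

lemma polyfun_prod: "(\<And>i. i \<in> I \<Longrightarrow> polyfun B (f i)) \<Longrightarrow> polyfun B (\<lambda>x. \<Prod>i\<in>I. f i x)"
  by (induction I rule: infinite_finite_induct) (auto intro: polyfun_const polyfun_mult)

lemma polyfun_det:
  "(\<And>i j. polyfun B (\<lambda>x. M x $ i $ j)) \<Longrightarrow> polyfun B (\<lambda>x. det (M x))"
  unfolding det_def by (intro polyfun_sum polyfun_mult polyfun_prod polyfun_const)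

lemma polyfun_continuous:
  assumes "polyfun B f" "\<And>g. g \<in> B \<Longrightarrow> continuous_on UNIV g"
  shows "continuous_on UNIV f"
  using assms(1) by induction
    (assumption | erule assms(2) | rule continuous_on_const continuous_on_add continuous_on_mult)+

lemma polyfun_mono:
  assumes "polyfun B f" "B \<subseteq> B'"
  shows "polyfun B' f"
  using assms(1)
proof induction
  case (polyfun_base f)
  then show ?case using assms(2) by (blast intro: polyfun.polyfun_base)
qed (rule polyfun.intros; assumption)+

definition coords :: "(complex ^ 'n \<Rightarrow> complex) set" where
  "coords = range (\<lambda>k x. x $ k)"

definition coords_cnj :: "(complex ^ 'n \<Rightarrow> complex) set" where
  "coords_cnj = coords \<union> range (\<lambda>k x. cnj (x $ k))"

lemma polyfun_coords_continuous: "polyfun coords f \<Longrightarrow> continuous_on UNIV f"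
  by (erule polyfun_continuous) (auto simp: coords_def intro!: continuous_intros)

text \<open>Sum and product rule keep the derivatives polynomial, so the entries of the Jacobian of
  \<open>symmetrization\<close> can be differentiated once more.\<close>

lemma polyfun_coords_wirtinger:
  assumes "polyfun coords f"
  shows "\<exists>a. (\<forall>k. polyfun coords (a k)) \<and> (\<forall>x. has_wirtinger f (\<lambda>k. a k x) (\<lambda>k. 0) x)"
  using assms
proof induction
  case (polyfun_const c)
  show ?case by (rule exI[of _ "\<lambda>k x. 0"]) (auto intro: has_wirtinger_const polyfun.polyfun_const)
next
  case (polyfun_base f)
  then obtain k where "f = (\<lambda>x. x $ k)" by (auto simp: coords_def)
  then show ?case
    by (intro exI[of _ "\<lambda>l x. if l = k then 1 else 0"]) (auto intro: has_wirtinger_coord polyfun.polyfun_const)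
next
  case (polyfun_add f g)
  then obtain a c where *: "\<forall>k. polyfun coords (a k)" "\<forall>x. has_wirtinger f (\<lambda>k. a k x) (\<lambda>k. 0) x"
     "\<forall>k. polyfun coords (c k)" "\<forall>x. has_wirtinger g (\<lambda>k. c k x) (\<lambda>k. 0) x" by blast
  show ?case
    by (rule exI[of _ "\<lambda>k x. a k x + c k x"])
       (intro conjI allI polyfun.polyfun_add *(1)[rule_format] *(3)[rule_format]
          has_wirtinger_eq_rhs[OF has_wirtinger_add[OF *(2)[rule_format] *(4)[rule_format]]]; simp)
next
  case (polyfun_mult f g)
  then obtain a c where *: "\<forall>k. polyfun coords (a k)" "\<forall>x. has_wirtinger f (\<lambda>k. a k x) (\<lambda>k. 0) x"
     "\<forall>k. polyfun coords (c k)" "\<forall>x. has_wirtinger g (\<lambda>k. c k x) (\<lambda>k. 0) x" by blast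
  show ?case
    by (rule exI[of _ "\<lambda>k x. f x * c k x + a k x * g x"])
       (intro conjI allI polyfun.polyfun_add polyfun.polyfun_mult polyfun_mult.hyps *(1)[rule_format] *(3)[rule_format]
          has_wirtinger_eq_rhs[OF has_wirtinger_mult[OF *(2)[rule_format] *(4)[rule_format]]]; simp)
qed

text \<open>Since the conjugate derivatives \<open>b\<close> are again polynomial, the lemma can be
  applied to them in turn; the metric consists of such second derivatives.\<close>

lemma polyfun_coords_cnj_wirtinger:
  assumes "polyfun coords_cnj f"
  shows "\<exists>a b. (\<forall>k. polyfun coords_cnj (b k)) \<and> (\<forall>x. has_wirtinger f (\<lambda>k. a k x) (\<lambda>k. b k x) x)"
  using assms
proof induction
  case (polyfun_const c)
  show ?case
    by (rule exI[of _ "\<lambda>k x. 0"], rule exI[of _ "\<lambda>k x. 0"]) (auto intro: has_wirtinger_const polyfun.polyfun_const)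
next
  case (polyfun_base f)
  then consider k where "f = (\<lambda>x. x $ k)" | k where "f = (\<lambda>x. cnj (x $ k))"
    by (auto simp: coords_def coords_cnj_def)
  then show ?case
  proof cases
    case 1
    then show ?thesis
      by (intro exI[of _ "\<lambda>l x. if l = k then 1 else 0"] exI[of _ "\<lambda>k x. 0"])
        (auto intro: has_wirtinger_coord polyfun.polyfun_const)
  next
    case 2
    then show ?thesis
      by (intro exI[of _ "\<lambda>l x. if l = k then 1 else 0"] exI[of _ "\<lambda>k x. 0"])
        (auto intro!: polyfun.polyfun_const intro: has_wirtinger_eq_rhs[OF has_wirtinger_cnj[OF has_wirtinger_coord]])
  qed
next
  case (polyfun_add f g)
  then obtain a b c d where *: "\<forall>k. polyfun coords_cnj (b k)" "\<forall>x. has_wirtinger f (\<lambda>k. a k x) (\<lambda>k. b k x) x"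
     "\<forall>k. polyfun coords_cnj (d k)" "\<forall>x. has_wirtinger g (\<lambda>k. c k x) (\<lambda>k. d k x) x" by blast
  show ?case
    by (rule exI[of _ "\<lambda>k x. a k x + c k x"], rule exI[of _ "\<lambda>k x. b k x + d k x"])
       (intro conjI allI polyfun.polyfun_add *(1)[rule_format] *(3)[rule_format]
          has_wirtinger_add[OF *(2)[rule_format] *(4)[rule_format]])
next
  case (polyfun_mult f g)
  then obtain a b c d where *: "\<forall>k. polyfun coords_cnj (b k)" "\<forall>x. has_wirtinger f (\<lambda>k. a k x) (\<lambda>k. b k x) x"
     "\<forall>k. polyfun coords_cnj (d k)" "\<forall>x. has_wirtinger g (\<lambda>k. c k x) (\<lambda>k. d k x) x" by blast
  show ?case
    by (rule exI[of _ "\<lambda>k x. f x * c k x + a k x * g x"], rule exI[of _ "\<lambda>k x. f x * d k x + b k x * g x"])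
       (intro conjI allI polyfun.polyfun_add polyfun.polyfun_mult polyfun_mult.hyps *(1)[rule_format] *(3)[rule_format]
          has_wirtinger_mult[OF *(2)[rule_format] *(4)[rule_format]])
qed

subsection \<open>Vieta's formulas\<close>

lemma index_ge_1: "1 \<le> index i"
  using card_gt_0_iff[of "{..i}"] by (auto simp: index_def Suc_le_eq)

lemma index_le_card: "index (i :: 'n::{finite,linorder}) \<le> CARD('n)"
  by (auto simp: index_def intro: card_mono)

lemma bij_betw_index: "bij_betw index (UNIV :: 'n::{finite,linorder} set) {1..CARD('n)}"
proof -
  have sub: "range (index :: 'n \<Rightarrow> nat) \<subseteq> {1..CARD('n)}"
    using index_ge_1 index_le_card by auto
  have "{1..CARD('n)} \<subseteq> range (index :: 'n \<Rightarrow> nat)"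
    using index_surj[where 'n = 'n] by fastforce
  with sub have *: "range (index :: 'n \<Rightarrow> nat) = {1..CARD('n)}" by blast
  then have "inj (index :: 'n \<Rightarrow> nat)"
    by (intro eq_card_imp_inj_on) auto
  then show ?thesis using * by (simp add: bij_betw_def)
qed

lemma inj_index: "inj (index :: 'n::{finite,linorder} \<Rightarrow> nat)"
  using bij_betw_index by (rule bij_betw_imp_inj_on)

lemma index_eq_iff [simp]: "index i = index j \<longleftrightarrow> i = j"
  using inj_index by (auto dest: injD)

lemma sum_index:
  "(\<Sum>i\<in>(UNIV :: 'n::{finite,linorder} set). g (index i)) = (\<Sum>k\<in>{1..CARD('n)}. g k)"
  by (rule sum.reindex_bij_betw[OF bij_betw_index])

lemma symmetrization_nth: "symmetrization Z $ k = esym (index k) Z"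
  by (simp add: symmetrization_def)

lemma esym_0: "esym 0 Z = 1"
  by (simp add: esym_def)

lemma esym_scale: "esym k (\<chi> i. c * Z $ i) = c ^ k * esym k Z"
  by (auto simp: esym_def sum_distrib_left prod.distrib intro!: sum.cong)

lemma cnj_esym: "cnj (esym k Z) = esym k (\<chi> i. cnj (Z $ i))"
  by (simp add: esym_def)

lemma atMost_eq_insert_0: "{..n::nat} = insert 0 {1..n}"
  by auto

text \<open>The monic polynomial \<open>t^n - u_1 t^(n-1) + u_2 t^(n-2) - ...\<close>, whose roots
  are the coordinates of any preimage of \<open>u\<close> under \<open>symmetrization\<close>. Given
  by coefficients, it makes sense before a preimage is known.\<close>

definition vieta :: "complex ^ 'n::{finite,linorder} \<Rightarrow> complex poly" where
  "vieta u = monom 1 CARD('n) + (\<Sum>k\<in>UNIV. monom ((-1) ^ index k * u $ k) (CARD('n) - index k))"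

lemma vieta_symmetrization:
  fixes Z :: "complex ^ 'n::{finite,linorder}"
  shows "vieta (symmetrization Z) = (\<Prod>i\<in>UNIV. [:- Z $ i, 1:])"
proof -
  \<comment> \<open>Negating all coordinates gives the factors of
    \<open>prod_linear_factors_esym\<close>; homogeneity of \<open>esym\<close> then produces the
    alternating signs.\<close>
  have "(\<Prod>i\<in>UNIV. [:- Z $ i, 1:]) = (\<Prod>i\<in>UNIV. [:(\<chi> i. (-1) * Z $ i) $ i, 1:])"
    by simp
  also have "\<dots> = (\<Sum>k\<le>CARD('n). monom ((-1) ^ k * esym k Z) (CARD('n) - k))"
    unfolding prod_linear_factors_esym esym_scale by (simp add: monom_altdef)
  also have "\<dots> = monom 1 CARD('n) + (\<Sum>k\<in>{1..CARD('n)}. monom ((-1) ^ k * esym k Z) (CARD('n) - k))"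
    by (simp add: atMost_eq_insert_0 esym_0)
  also have "\<dots> = vieta (symmetrization Z)"
    by (simp add: vieta_def symmetrization_nth
        sum_index[where g = "\<lambda>k. monom ((-1) ^ k * esym k Z) (CARD('n) - k)"])
  finally show ?thesis by simp
qed

lemma poly_vieta:
  fixes u :: "complex ^ 'n::{finite,linorder}"
  shows "poly (vieta u) t = t ^ CARD('n) + (\<Sum>k\<in>UNIV. (-1) ^ index k * u $ k * t ^ (CARD('n) - index k))"
  by (simp add: vieta_def poly_monom poly_sum)

lemma poly_vieta_symmetrization:
  "poly (vieta (symmetrization Z)) t = (\<Prod>i\<in>UNIV. t - Z $ i)"
  by (simp add: vieta_symmetrization poly_prod)

lemma coeff_vieta:
  fixes u :: "complex ^ 'n::{finite,linorder}"
  shows "coeff (vieta u) (CARD('n) - index k) = (-1) ^ index k * u $ k"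
    and "coeff (vieta u) CARD('n) = 1"
proof -
  have *: "CARD('n) - index i < CARD('n)" for i :: 'n
    using index_ge_1[of i] by (simp add: Suc_le_eq)
  have "CARD('n) - index i = CARD('n) - index k \<longleftrightarrow> i = k" for i
    using index_le_card[of i] index_le_card[of k] index_eq_iff[of i k] by linarith
  then show "coeff (vieta u) (CARD('n) - index k) = (-1) ^ index k * u $ k"
    using *[of k] by (simp add: vieta_def coeff_sum)
  have "CARD('n) - index i \<noteq> CARD('n)" for i :: 'n using *[of i] by simp
  then show "coeff (vieta u) CARD('n) = 1"
    by (simp add: vieta_def coeff_sum)
qed

lemma inj_vieta:
  fixes u v :: "complex ^ 'n::{finite,linorder}"
  assumes "vieta u = vieta v"
  shows "u = v"
proof -
  have "u $ k = v $ k" for k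
    using arg_cong[OF assms, of "\<lambda>p. coeff p (CARD('n) - index k)"] by (simp add: coeff_vieta)
  then show ?thesis by (simp add: vec_eq_iff)
qed

lemma degree_vieta: "degree (vieta (u :: complex ^ 'n::{finite,linorder})) = CARD('n)"
proof (rule antisym)
  show "degree (vieta u) \<le> CARD('n)"
    unfolding vieta_def
    by (intro degree_add_le degree_sum_le order.trans[OF degree_monom_le]) auto
  show "CARD('n) \<le> degree (vieta u)"
    by (rule le_degree) (simp add: coeff_vieta)
qed

text \<open>By the fundamental theorem of algebra \<open>vieta u\<close> splits into linear factors,
  and its roots with multiplicity form a preimage.\<close>

lemma surj_symmetrization:
  fixes u :: "complex ^ 'n::{finite,linorder}"
  obtains Z where "symmetrization Z = u"
proof -
  obtain root where root: "smult (lead_coeff (vieta u)) (\<Prod>i<degree (vieta u). [:- root i, 1:]) = vieta u"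
    by (rule complex_poly_decompose')
  \<comment> \<open>The roots are numbered from 0, the coordinates from 1.\<close>
  define Z :: "complex ^ 'n::{finite,linorder}" where "Z = (\<chi> i. root (index i - 1))"
  have "bij_betw (\<lambda>i. i - 1) {1..CARD('n)} {..<CARD('n)}"
    by (rule bij_betw_byWitness[where f' = Suc]) auto
  then have bij: "bij_betw (\<lambda>i. index i - 1) (UNIV :: 'n set) {..<CARD('n)}"
    using bij_betw_trans[OF bij_betw_index] by (simp add: o_def)
  have "vieta (symmetrization Z) = (\<Prod>i\<in>(UNIV :: 'n set). [:- root (index i - 1), 1:])"
    by (simp add: vieta_symmetrization Z_def)
  also have "\<dots> = (\<Prod>i<CARD('n). [:- root i, 1:])"
    by (rule prod.reindex_bij_betw[OF bij])
  also have "\<dots> = vieta u"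
    using root by (simp add: degree_vieta coeff_vieta)
  finally show thesis using that inj_vieta by blast
qed

section \<open>Stability of roots under perturbation of the coefficients\<close>

lemma norm_poly_vieta_diff:
  fixes u v :: "complex ^ 'n::{finite,linorder}"
  shows "norm (poly (vieta u) t - poly (vieta v) t) \<le> norm (u - v) * (\<Sum>k\<in>(UNIV :: 'n set). norm t ^ (CARD('n) - index k))"
proof -
  \<comment> \<open>Both polynomials are monic, so the leading terms cancel.\<close>
  have "poly (vieta u) t - poly (vieta v) t = (\<Sum>k\<in>UNIV. (-1) ^ index k * (u - v) $ k * t ^ (CARD('n) - index k))"
    by (simp add: poly_vieta sum_subtractf[symmetric] algebra_simps)
  also have "norm \<dots> \<le> (\<Sum>k\<in>(UNIV :: 'n set). norm (u - v) * norm t ^ (CARD('n) - index k))"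
  proof (rule sum_norm_le)
    fix k
    show "norm ((-1) ^ index k * (u - v) $ k * t ^ (CARD('n) - index k)) \<le> norm (u - v) * norm t ^ (CARD('n) - index k)"
      unfolding norm_mult norm_power
      using Finite_Cartesian_Product.norm_nth_le[of "u - v" k] by (intro mult_right_mono) simp_all
  qed
  finally show ?thesis by (simp add: sum_distrib_left)
qed

text \<open>At a point \<open>t\<close> with \<open>norm t \<ge> \<rho>\<close> the polynomial with
  roots \<open>Z $ i\<close> is at least a constant times \<open>norm t ^ n\<close>. A small change
  of the coefficients is dominated by this, so it cannot create a root there.\<close>

lemma roots_in_disc_stable:
  fixes Z :: "complex ^ 'n::{finite,linorder}"
  assumes Z: "\<And>i. norm (Z $ i) < \<rho>" and \<rho>: "0 < \<rho>" "\<rho> \<le> 1"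
  obtains \<delta> where "\<delta> > 0"
    "\<And>W i. dist (symmetrization W) (symmetrization Z) < \<delta> \<Longrightarrow> norm (W $ i) < \<rho>"
proof -
  \<comment> \<open>For \<open>norm t \<ge> \<rho>\<close> each factor satisfies
    \<open>norm (t - Z $ i) \<ge> (1 - norm (Z $ i) / \<rho>) * norm t\<close>; \<open>c\<close>
    collects these constants, and \<open>\<delta>\<close> keeps the perturbation below
    \<open>c * norm t ^ n\<close>.\<close>
  define c where "c = (\<Prod>i\<in>UNIV. 1 - norm (Z $ i) / \<rho>)"
  define \<delta> where "\<delta> = c * \<rho> ^ CARD('n) / CARD('n)"
  have c: "c > 0" unfolding c_def using Z \<rho> by (intro prod_pos) auto
  have "norm (W $ i) < \<rho>" if W: "dist (symmetrization W) (symmetrization Z) < \<delta>" for W i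
  proof (rule ccontr)
    define t where "t = W $ i"
    assume "\<not> norm (W $ i) < \<rho>"
    then have t: "\<rho> \<le> norm t" by (simp add: t_def)
    have tpos: "norm t ^ CARD('n) > 0" using t \<rho> by (intro zero_less_power) linarith
    have "poly (vieta (symmetrization W)) t = 0"
      by (auto simp: poly_vieta_symmetrization prod_zero_iff t_def)
    then have "norm (poly (vieta (symmetrization Z)) t) \<le>
        norm (symmetrization W - symmetrization Z) * (\<Sum>k\<in>(UNIV :: 'n set). norm t ^ (CARD('n) - index k))"
      using norm_poly_vieta_diff[of "symmetrization W" t "symmetrization Z"] by simp
    also have "\<dots> \<le> norm (symmetrization W - symmetrization Z) * (\<Sum>k\<in>(UNIV :: 'n set). norm t ^ CARD('n) / \<rho> ^ CARD('n))"
    proof (intro mult_left_mono sum_mono)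
      fix k :: 'n
      \<comment> \<open>From \<open>\<rho> \<le> 1\<close> and \<open>\<rho> \<le> norm t\<close>
        every lower power is bounded by a multiple of the top one, uniformly in
        \<open>t\<close>.\<close>
      have "norm t ^ (CARD('n) - index k) * \<rho> ^ CARD('n) \<le> norm t ^ (CARD('n) - index k) * norm t ^ index k"
      proof (rule mult_left_mono)
        have "\<rho> ^ CARD('n) \<le> \<rho> ^ index k"
          using \<rho> index_le_card[of k] by (intro power_decreasing) auto
        also have "\<dots> \<le> norm t ^ index k" using t \<rho> by (intro power_mono) auto
        finally show "\<rho> ^ CARD('n) \<le> norm t ^ index k" .
      qed simp
      also have "\<dots> = norm t ^ CARD('n)"
        using index_le_card[of k] by (simp add: power_add[symmetric])
      finally show "norm t ^ (CARD('n) - index k) \<le> norm t ^ CARD('n) / \<rho> ^ CARD('n)"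
        using \<rho> by (simp add: field_simps)
    qed simp
    also have "\<dots> = norm (symmetrization W - symmetrization Z) * (CARD('n) * (norm t ^ CARD('n) / \<rho> ^ CARD('n)))"
      by simp
    also have "\<dots> < \<delta> * (CARD('n) * (norm t ^ CARD('n) / \<rho> ^ CARD('n)))"
      using W tpos \<rho> by (intro mult_strict_right_mono mult_pos_pos divide_pos_pos) (auto simp: dist_norm)
    also have "\<dots> = c * norm t ^ CARD('n)"
      using \<rho> by (simp add: \<delta>_def)
    also have "\<dots> = (\<Prod>i\<in>UNIV. (1 - norm (Z $ i) / \<rho>) * norm t)"
      by (simp add: c_def prod.distrib)
    also have "\<dots> \<le> (\<Prod>i\<in>UNIV. norm (t - Z $ i))"
    proof (rule prod_mono, intro conjI)
      fix i
      show "0 \<le> (1 - norm (Z $ i) / \<rho>) * norm t"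
        using Z[of i] \<rho> by (intro mult_nonneg_nonneg) (auto simp: field_simps)
      have "norm (Z $ i) * 1 \<le> norm (Z $ i) * (norm t / \<rho>)"
        using t \<rho> by (intro mult_left_mono) (auto simp: field_simps)
      then have "(1 - norm (Z $ i) / \<rho>) * norm t \<le> norm t - norm (Z $ i)"
        by (simp add: algebra_simps)
      also have "\<dots> \<le> norm (t - Z $ i)" by (rule norm_triangle_ineq2)
      finally show "(1 - norm (Z $ i) / \<rho>) * norm t \<le> norm (t - Z $ i)" .
    qed
    also have "\<dots> = norm (poly (vieta (symmetrization Z)) t)"
      by (simp add: poly_vieta_symmetrization prod_norm)
    finally show False by simp
  qed
  moreover have "\<delta> > 0" unfolding \<delta>_def using c \<rho> by simp
  ultimately show thesis using that by blast
qed

text \<open>Finitely many coordinates leave room for a common radius below 1; on the closed disc of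
  that radius functions holomorphic on the unit disc are bounded.\<close>

lemma polydisc_radius:
  fixes Z :: "complex ^ 'n"
  assumes "Z \<in> polydisc"
  obtains \<rho> where "0 < \<rho>" "\<rho> < 1" "\<And>i. norm (Z $ i) < \<rho>"
proof -
  define m where "m = Max (range (\<lambda>i. norm (Z $ i)))"
  have le: "norm (Z $ i) \<le> m" for i unfolding m_def by (rule Max_ge) auto
  have "m < 1" unfolding m_def using assms by (subst Max_less_iff) (auto simp: polydisc_def)
  moreover have "0 \<le> m" using le norm_ge_zero order.trans by blast
  \<comment> \<open>The midpoint of \<open>m\<close> and 1 is positive even when
    \<open>m = 0\<close>.\<close>
  ultimately show thesis
    using le_less_trans[OF le, of "(1 + m) / 2"] by (intro that[of "(1 + m) / 2"]) simp_all
qed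

text \<open>This is root stability with radius 1. Since every point has a preimage, the formulas for
  the kernel and the induced map are thereby available on a whole ball.\<close>

lemma symmetrized_polydisc_nhd:
  fixes Z :: "complex ^ 'n::{finite,linorder}"
  assumes "Z \<in> polydisc"
  obtains \<delta> where "\<delta> > 0" "\<And>W. symmetrization W \<in> ball (symmetrization Z) \<delta> \<Longrightarrow> W \<in> polydisc"
proof -
  have "norm (Z $ i) < 1" for i using assms by (simp add: polydisc_def)
  from roots_in_disc_stable[OF this] obtain \<delta> where "\<delta> > 0"
    "\<And>W i. dist (symmetrization W) (symmetrization Z) < \<delta> \<Longrightarrow> norm (W $ i) < 1" by auto
  then show thesis using that[of \<delta>] by (simp add: polydisc_def dist_commute)
qed

subsection \<open>Companion matrices and symmetric polynomials\<close>

text \<open>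
  The signs and the first column are chosen so that the rows of the Vandermonde matrix with
  decreasing exponents are left eigenvectors; the entries are polynomial in \<open>u\<close>.
\<close>

definition companion :: "complex ^ 'n::{finite,linorder} \<Rightarrow> complex ^ 'n::{finite,linorder} ^ 'n::{finite,linorder}" where
  "companion u = (\<chi> k j. if index j = 1 then (-1) ^ (index k + 1) * u $ k
                          else if Suc (index k) = index j then 1 else 0)"

definition vandermonde :: "complex ^ 'n::{finite,linorder} \<Rightarrow> complex ^ 'n::{finite,linorder} ^ 'n::{finite,linorder}" where
  "vandermonde Z = (\<chi> i j. Z $ i ^ (CARD('n) - index j))"

lemma vandermonde_companion:
  fixes Z :: "complex ^ 'n::{finite,linorder}"
  shows "(vandermonde Z ** companion (symmetrization Z)) $ i $ j = Z $ i * vandermonde Z $ i $ j"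
proof (cases "index j = 1")
  case True
  \<comment> \<open>The first column reproduces the equation of the root \<open>Z $ i\<close>,
    solved for its top power. Each other column merely raises an exponent by one.\<close>
  have "poly (vieta (symmetrization Z)) (Z $ i) = 0"
    by (auto simp: poly_vieta_symmetrization prod_zero_iff)
  then have "(\<Sum>k\<in>UNIV. - ((-1) ^ index k * symmetrization Z $ k * Z $ i ^ (CARD('n) - index k))) = Z $ i ^ CARD('n)"
    unfolding poly_vieta sum_negf by (simp add: add_eq_0_iff)
  moreover have "Z $ i * Z $ i ^ (CARD('n) - 1) = Z $ i ^ CARD('n)"
    by (metis power_minus_mult zero_less_card_finite mult.commute)
  ultimately show ?thesis
    by (simp add: True matrix_matrix_mult_def vandermonde_def companion_def mult.commute mult.left_commute)
next
  case False
  then have *: "1 \<le> index j - 1" "index j - 1 \<le> CARD('n)" "index j \<le> CARD('n)"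
    using index_ge_1[of j] index_le_card[of j] by auto
  then obtain k0 :: 'n where k0: "index k0 = index j - 1"
    using index_surj by metis
  have eq: "Suc (index k) = index j \<longleftrightarrow> k = k0" for k
    using k0 * index_eq_iff[of k k0] by auto
  have "(\<Sum>k\<in>(UNIV :: 'n set). Z $ i ^ (CARD('n) - index k) * (if Suc (index k) = index j then 1 else 0))
      = (\<Sum>k\<in>UNIV. if k = k0 then Z $ i ^ (CARD('n) - index k) else 0)"
    by (rule sum.cong) (auto simp: eq)
  also have "\<dots> = Z $ i ^ (CARD('n) - index k0)" by simp
  also have "\<dots> = Z $ i * Z $ i ^ (CARD('n) - index j)"
    using * k0 by (metis Suc_diff_le Suc_diff_1 diff_Suc_Suc index_ge_1 less_eq_Suc_le One_nat_def power_Suc)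
  finally show ?thesis
    using False by (simp add: matrix_matrix_mult_def vandermonde_def companion_def)
qed

text \<open>A kernel vector lists the coefficients of a polynomial of degree below \<open>n\<close>
  with \<open>n\<close> distinct roots, so it vanishes.\<close>

lemma det_vandermonde_nonzero:
  fixes Z :: "complex ^ 'n::{finite,linorder}"
  assumes "inj (($) Z)"
  shows "det (vandermonde Z) \<noteq> 0"
proof -
  have "x = 0" if x: "vandermonde Z *v x = 0" for x
  proof -
    define q where "q = (\<Sum>j\<in>UNIV. monom (x $ j) (CARD('n) - index j))"
    have coeff_q: "coeff q m = (\<Sum>j\<in>UNIV. if CARD('n) - index j = m then x $ j else 0)" for m
      by (simp add: q_def coeff_sum)
    have root: "poly q (Z $ i) = 0" for i
      using arg_cong[OF x, of "\<lambda>v. v $ i"]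
      by (simp add: q_def poly_sum poly_monom matrix_vector_mult_def vandermonde_def mult.commute)
    have "q = 0"
    proof (rule ccontr)
      assume "q \<noteq> 0"
      have "degree q \<le> CARD('n) - 1"
        unfolding q_def
        by (intro degree_sum_le order.trans[OF degree_monom_le] diff_le_mono2 index_ge_1) simp
      moreover have "CARD('n) \<le> card {t. poly q t = 0}"
        using card_mono[OF poly_roots_finite[OF \<open>q \<noteq> 0\<close>], of "range (($) Z)"] root
          card_image[OF assms] by auto
      moreover have "card {t. poly q t = 0} \<le> degree q"
        using \<open>q \<noteq> 0\<close> by (rule card_poly_roots_bound)
      ultimately show False
        using zero_less_card_finite[where 'a = 'n] by linarith
    qed
    have "x $ j = 0" for j
    proof -
      have "CARD('n) - index i = CARD('n) - index j \<longleftrightarrow> i = j" for i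
        using index_le_card[of i] index_le_card[of j] index_eq_iff[of i j] by linarith
      then have "coeff q (CARD('n) - index j) = x $ j"
        by (simp add: coeff_q)
      then show ?thesis using \<open>q = 0\<close> by simp
    qed
    then show ?thesis by (simp add: vec_eq_iff)
  qed
  then show ?thesis
    by (metis invertible_det_nz invertible_left_inverse matrix_left_invertible_ker)
qed

section \<open>Determinants of polynomials in the companion matrix\<close>

definition matpow :: "complex ^ 'n ^ 'n \<Rightarrow> nat \<Rightarrow> complex ^ 'n ^ 'n" where
  "matpow A k = (((**) A) ^^ k) (mat 1)"

text \<open>The coefficients form a plain sequence with a degree bound, so that they can themselves
  be polynomial functions of a point.\<close>

definition matpoly :: "(nat \<Rightarrow> complex) \<Rightarrow> nat \<Rightarrow> complex ^ 'n ^ 'n \<Rightarrow> complex ^ 'n ^ 'n" where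
  "matpoly a d A = (\<chi> i j. \<Sum>k\<le>d. a k * matpow A k $ i $ j)"

lemma vandermonde_matpow:
  "(vandermonde Z ** matpow (companion (symmetrization Z)) k) $ i $ j = Z $ i ^ k * vandermonde Z $ i $ j"
proof (induction k arbitrary: j)
  case 0
  then show ?case by (simp add: matpow_def)
next
  case (Suc k)
  let ?C = "companion (symmetrization Z)"
  have "vandermonde Z ** matpow ?C (Suc k) = (vandermonde Z ** ?C) ** matpow ?C k"
    by (simp add: matpow_def matrix_mul_assoc)
  then have "(vandermonde Z ** matpow ?C (Suc k)) $ i $ j =
      (\<Sum>l\<in>UNIV. Z $ i * vandermonde Z $ i $ l * matpow ?C k $ l $ j)"
    by (simp only: matrix_matrix_mult_def[of "vandermonde Z ** ?C"] vandermonde_companion vec_lambda_beta)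
  also have "\<dots> = Z $ i * (vandermonde Z ** matpow ?C k) $ i $ j"
    by (simp add: matrix_matrix_mult_def sum_distrib_left mult.assoc)
  finally show ?case by (simp add: Suc.IH)
qed

lemma vandermonde_matpoly:
  "vandermonde Z ** matpoly a d (companion (symmetrization Z)) =
     (\<chi> i. (\<Sum>k\<le>d. a k * Z $ i ^ k) *s vandermonde Z $ i)"
proof -
  let ?C = "companion (symmetrization Z)"
  have "(vandermonde Z ** matpoly a d ?C) $ i $ j = (\<Sum>k\<le>d. a k * Z $ i ^ k) * vandermonde Z $ i $ j" for i j
  proof -
    have "(vandermonde Z ** matpoly a d ?C) $ i $ j =
        (\<Sum>l\<in>UNIV. \<Sum>k\<le>d. a k * (vandermonde Z $ i $ l * matpow ?C k $ l $ j))"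
      by (simp add: matrix_matrix_mult_def matpoly_def sum_distrib_left mult.left_commute)
    also have "\<dots> = (\<Sum>k\<le>d. \<Sum>l\<in>UNIV. a k * (vandermonde Z $ i $ l * matpow ?C k $ l $ j))"
      by (rule sum.swap)
    also have "\<dots> = (\<Sum>k\<le>d. a k * (vandermonde Z ** matpow ?C k) $ i $ j)"
      by (simp add: matrix_matrix_mult_def sum_distrib_left)
    also have "\<dots> = (\<Sum>k\<le>d. a k * Z $ i ^ k) * vandermonde Z $ i $ j"
      by (simp add: vandermonde_matpow sum_distrib_right mult.assoc)
    finally show ?thesis .
  qed
  then show ?thesis by (simp add: vec_eq_iff)
qed

text \<open>With \<open>V\<close> the Vandermonde matrix and \<open>q\<close> the polynomial,
  \<open>V q(C)\<close> is \<open>V\<close> with row \<open>i\<close> scaled by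
  \<open>q (Z $ i)\<close>. Taking determinants, \<open>det V\<close> cancels.\<close>

lemma det_matpoly_companion_distinct:
  fixes Z :: "complex ^ 'n::{finite,linorder}"
  assumes "inj (($) Z)"
  shows "det (matpoly a d (companion (symmetrization Z))) = (\<Prod>i\<in>UNIV. \<Sum>k\<le>d. a k * Z $ i ^ k)"
proof -
  have "det (vandermonde Z) * det (matpoly a d (companion (symmetrization Z))) =
      (\<Prod>i\<in>UNIV. \<Sum>k\<le>d. a k * Z $ i ^ k) * det (vandermonde Z)"
    unfolding det_mul[symmetric] vandermonde_matpoly det_rows_mul by simp
  then show ?thesis using det_vandermonde_nonzero[OF assms] by (simp add: mult.commute)
qed

lemma polyfun_esym: "polyfun coords (esym k)"
  unfolding esym_def[abs_def]
  by (intro polyfun_sum polyfun_prod polyfun_base) (simp add: coords_def)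

lemma polyfun_companion: "polyfun coords (\<lambda>u. companion u $ i $ j)"
proof (cases "index j = 1")
  case True
  have "polyfun coords (\<lambda>u. (-1) ^ (index i + 1) * u $ i)"
    by (intro polyfun_mult polyfun_const polyfun_base) (simp add: coords_def)
  then show ?thesis using True by (simp add: companion_def)
qed (simp add: companion_def polyfun_const)

lemma polyfun_matpow:
  assumes "\<And>i j. polyfun B (\<lambda>x. A x $ i $ j)"
  shows "polyfun B (\<lambda>x. matpow (A x) k $ i $ j)"
proof (induction k arbitrary: i j)
  case 0
  then show ?case by (simp add: matpow_def polyfun_const mat_def)
next
  case (Suc k)
  have "polyfun B (\<lambda>x. \<Sum>l\<in>UNIV. A x $ i $ l * matpow (A x) k $ l $ j)"
    by (intro polyfun_sum polyfun_mult assms Suc.IH)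
  then show ?case by (simp add: matpow_def matrix_matrix_mult_def)
qed

lemma polyfun_det_matpoly:
  assumes "\<And>k. k \<le> d \<Longrightarrow> polyfun B (a k)" "\<And>i j. polyfun B (\<lambda>x. A x $ i $ j)"
  shows "polyfun B (\<lambda>x. det (matpoly (\<lambda>k. a k x) d (A x)))"
proof (rule polyfun_det)
  fix i j
  have "polyfun B (\<lambda>x. \<Sum>k\<le>d. a k x * matpow (A x) k $ i $ j)"
    by (intro polyfun_sum polyfun_mult assms(1) polyfun_matpow assms(2)) simp
  then show "polyfun B (\<lambda>x. matpoly (\<lambda>k. a k x) d (A x) $ i $ j)"
    by (simp add: matpoly_def)
qed

lemma continuous_on_symmetrization: "continuous_on UNIV symmetrization"
  unfolding symmetrization_def[abs_def]
  by (intro continuous_on_vec_lambda polyfun_coords_continuous polyfun_esym)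

text \<open>Both sides are continuous in \<open>Z\<close> and agree for distinct coordinates, so
  they agree in the limit at coinciding ones.\<close>

lemma det_matpoly_companion:
  fixes Z :: "complex ^ 'n::{finite,linorder}"
  shows "det (matpoly a d (companion (symmetrization Z))) = (\<Prod>i\<in>UNIV. \<Sum>k\<le>d. a k * Z $ i ^ k)"
proof -
  \<comment> \<open>Distinct multiples of \<open>\<epsilon>\<close> separate equal coordinates, and
    unequal ones collide for at most one \<open>\<epsilon>\<close>.\<close>
  define Y :: "complex \<Rightarrow> complex ^ 'n::{finite,linorder}" where "Y = (\<lambda>\<epsilon>. \<chi> i. Z $ i + \<epsilon> * of_nat (index i))"
  define G where "G = (\<lambda>\<epsilon>. det (matpoly a d (companion (symmetrization (Y \<epsilon>)))) -
    (\<Prod>i\<in>UNIV. \<Sum>k\<le>d. a k * Y \<epsilon> $ i ^ k))"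
  have contY: "continuous_on UNIV Y"
    unfolding Y_def by (intro continuous_on_vec_lambda continuous_intros)
  have cont1: "continuous_on UNIV (\<lambda>u :: complex ^ 'n::{finite,linorder}. det (matpoly a d (companion u)))"
    by (intro polyfun_coords_continuous polyfun_det_matpoly polyfun_const polyfun_companion)
  have "continuous_on UNIV (\<lambda>\<epsilon>. det (matpoly a d (companion (symmetrization (Y \<epsilon>)))))"
    by (rule continuous_on_compose2[OF cont1 continuous_on_compose2[OF continuous_on_symmetrization contY]]) auto
  moreover have "continuous_on UNIV (\<lambda>\<epsilon>. \<Prod>i\<in>UNIV. \<Sum>k\<le>d. a k * Y \<epsilon> $ i ^ k)"
    by (intro continuous_intros contY)
  ultimately have "continuous_on UNIV G"
    unfolding G_def by (rule continuous_on_diff)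
  then have lim: "(G \<longlongrightarrow> G 0) (at 0)"
    by (simp add: continuous_on_def)
  have "eventually (\<lambda>\<epsilon>. \<forall>i j. i \<noteq> j \<longrightarrow> Y \<epsilon> $ i \<noteq> Y \<epsilon> $ j) (at 0)"
  proof (intro eventually_all_finite)
    fix i j
    show "eventually (\<lambda>\<epsilon>. i \<noteq> j \<longrightarrow> Y \<epsilon> $ i \<noteq> Y \<epsilon> $ j) (at 0)"
    proof (cases "i = j")
      case False
      define e0 where "e0 = (Z $ i - Z $ j) / (of_nat (index j) - of_nat (index i))"
      have "eventually (\<lambda>\<epsilon>. \<epsilon> \<noteq> e0) (at 0)"
        using eventually_neq_at_within by blast
      then show ?thesis
      proof eventually_elim
        case (elim \<epsilon>)
        have ne: "of_nat (index j) - of_nat (index i) \<noteq> (0::complex)"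
          using False by simp
        have "Y \<epsilon> $ i = Y \<epsilon> $ j \<Longrightarrow> \<epsilon> * (of_nat (index j) - of_nat (index i)) = Z $ i - Z $ j"
          unfolding Y_def by (simp add: algebra_simps)
        then show ?case
          using elim ne unfolding e0_def by (metis nonzero_mult_div_cancel_right)
      qed
    qed auto
  qed
  then have "eventually (\<lambda>\<epsilon>. G \<epsilon> = 0) (at 0)"
  proof eventually_elim
    case (elim \<epsilon>)
    then have "inj (($) (Y \<epsilon>))" by (auto simp: inj_def)
    then show ?case unfolding G_def by (simp only: det_matpoly_companion_distinct) simp
  qed
  then have "(G \<longlongrightarrow> 0) (at 0)"
    by (rule tendsto_eventually)
  then have "G 0 = 0"
    using lim tendsto_unique trivial_limit_at by blast
  moreover have "Y 0 = Z" by (simp add: Y_def)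
  ultimately show ?thesis by (simp add: G_def)
qed

text \<open>
  Substituting \<open>2 * T\<close> for \<open>T\<close> and subtracting \<open>2 ^ n\<close> times the original sum eliminates the leading
  coefficient.
\<close>

lemma coefficients_in_subspace:
  fixes c :: "nat \<Rightarrow> 'a \<Rightarrow> complex"
  assumes add: "\<And>f g. f \<in> M \<Longrightarrow> g \<in> M \<Longrightarrow> (\<lambda>x. f x + g x) \<in> M"
    and scale: "\<And>f s. f \<in> M \<Longrightarrow> (\<lambda>x. s * f x) \<in> M"
    and sum: "\<And>T. (\<lambda>x. \<Sum>k\<le>n. T ^ k * c k x) \<in> M"
    and "k \<le> n"
  shows "c k \<in> M"
  using sum \<open>k \<le> n\<close>
proof (induction n arbitrary: c k)
  case 0
  then show ?case using "0.prems"(1)[of 1] by simp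
next
  case (Suc n)
  have IH: "c j \<in> M" if "j \<le> n" for j
  proof -
    have "(\<lambda>x. \<Sum>k\<le>n. T ^ k * ((2 ^ k - 2 ^ Suc n) * c k x)) \<in> M" for T
    proof -
      have "(\<lambda>x. (\<Sum>k\<le>Suc n. (2 * T) ^ k * c k x) + (- (2 ^ Suc n)) * (\<Sum>k\<le>Suc n. T ^ k * c k x)) \<in> M"
        by (intro add scale Suc.prems(1))
      moreover have eq: "(\<Sum>k\<le>Suc n. (2 * T) ^ k * c k x) + (- (2 ^ Suc n)) * (\<Sum>k\<le>Suc n. T ^ k * c k x) =
          (\<Sum>k\<le>n. T ^ k * ((2 ^ k - 2 ^ Suc n) * c k x))" for x
      proof -
        have "(\<Sum>k\<le>Suc n. (2 * T) ^ k * c k x) + (- (2 ^ Suc n)) * (\<Sum>k\<le>Suc n. T ^ k * c k x) =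
            (\<Sum>k\<le>Suc n. T ^ k * ((2 ^ k - 2 ^ Suc n) * c k x))"
          unfolding sum_distrib_left sum.distrib[symmetric]
          by (rule sum.cong) (auto simp: algebra_simps power_mult_distrib)
        then show ?thesis by simp
      qed
      ultimately show ?thesis unfolding eq by blast
    qed
    then have "(\<lambda>x. (2 ^ j - 2 ^ Suc n) * c j x) \<in> M"
      using Suc.IH[of "\<lambda>k x. (2 ^ k - 2 ^ Suc n) * c k x"] that by blast
    then have "(\<lambda>x. inverse (2 ^ j - 2 ^ Suc n) * ((2 ^ j - 2 ^ Suc n) * c j x)) \<in> M"
      by (rule scale)
    moreover have "(2::complex) ^ j - 2 ^ Suc n \<noteq> 0"
    proof -
      have "(2::nat) ^ j \<noteq> 2 ^ Suc n" using that power_inject_exp[of "2::nat" j "Suc n"] by simp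
      then have "of_nat (2 ^ j) \<noteq> (of_nat (2 ^ Suc n) :: complex)" unfolding of_nat_eq_iff .
      then show ?thesis by simp
    qed
    ultimately show ?thesis by (simp add: mult.assoc[symmetric])
  qed
  have top: "c (Suc n) \<in> M"
  proof -
    have part: "(\<lambda>x. \<Sum>k\<in>A. c k x) \<in> M" if "finite A" "A \<subseteq> {..n}" for A
      using that
    proof induction
      case empty
      then show ?case using scale[OF Suc.prems(1)[of 0], of 0] by simp
    next
      case (insert j A)
      then show ?case using add[OF IH[of j]] by simp
    qed
    \<comment> \<open>At \<open>T = 1\<close> the sum is that of all coefficients; removing those
      already treated leaves the top one.\<close>
    have "(\<lambda>x. (\<Sum>k\<le>Suc n. 1 ^ k * c k x) + (-1) * (\<Sum>k\<le>n. c k x)) \<in> M"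
      by (intro add scale part Suc.prems(1)) auto
    then show ?thesis by simp
  qed
  show ?case using IH top \<open>k \<le> Suc n\<close> by (cases "k = Suc n") auto
qed

text \<open>The product of the \<open>p (Z $ i) + T\<close> is the generating polynomial in
  \<open>T\<close> of the symmetric functions of the values. For each \<open>T\<close> it equals
  \<open>det ((p + T)(C))\<close>, a polynomial in \<open>symmetrization Z\<close>, and
  \<open>coefficients_in_subspace\<close> passes this on to the coefficients.\<close>

lemma esym_poly_eq_polyfun_symmetrization:
  fixes p :: "complex poly"
  assumes "k \<le> CARD('n::{finite,linorder})"
  obtains P where "polyfun coords P"
    "\<And>Z :: complex ^ 'n::{finite,linorder}. esym k (\<chi> i. poly p (Z $ i)) = P (symmetrization Z)"
proof -
  define M where "M = {G. \<exists>P. polyfun coords P \<and> (\<forall>Z :: complex ^ 'n::{finite,linorder}. G Z = P (symmetrization Z))}"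
  have "(\<lambda>Z. esym (CARD('n) - m) (\<chi> i. poly p (Z $ i))) \<in> M" if "m \<le> CARD('n)" for m
    using _ _ _ that
  proof (rule coefficients_in_subspace)
    fix f g assume "f \<in> M" "g \<in> M"
    then show "(\<lambda>x. f x + g x) \<in> M"
      unfolding M_def using polyfun_add by force
  next
    fix f s assume "f \<in> M"
    then obtain P where "polyfun coords P" "\<forall>Z. f Z = P (symmetrization Z)" unfolding M_def by blast
    then show "(\<lambda>x. s * f x) \<in> M"
      unfolding M_def by (auto intro!: exI[of _ "\<lambda>x. s * P x"] polyfun_mult polyfun_const)
  next
    fix T
    let ?q = "p + [:T:]"
    have "(\<Sum>m\<le>CARD('n). T ^ m * esym (CARD('n) - m) (\<chi> i. poly p (Z $ i))) =
        det (matpoly (coeff ?q) (degree ?q) (companion (symmetrization Z)))" for Z :: "complex ^ 'n::{finite,linorder}"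
    proof -
      have "(\<Sum>m\<le>CARD('n). T ^ m * esym (CARD('n) - m) (\<chi> i. poly p (Z $ i))) =
          (\<Sum>m\<le>CARD('n). esym m (\<chi> i. poly p (Z $ i)) * T ^ (CARD('n) - m))"
        by (rule sum.reindex_bij_witness[of _ "\<lambda>m. CARD('n) - m" "\<lambda>m. CARD('n) - m"]) auto
      also have "\<dots> = poly (\<Prod>i\<in>UNIV. [:(\<chi> i. poly p (Z $ i)) $ i, 1:]) T"
        unfolding prod_linear_factors_esym by (simp add: poly_sum)
      also have "\<dots> = (\<Prod>i\<in>UNIV. poly ?q (Z $ i))"
        by (simp add: poly_prod)
      also have "\<dots> = det (matpoly (coeff ?q) (degree ?q) (companion (symmetrization Z)))"
        unfolding det_matpoly_companion by (simp add: poly_altdef)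
      finally show ?thesis .
    qed
    moreover have "polyfun coords (\<lambda>u :: complex ^ 'n::{finite,linorder}. det (matpoly (coeff ?q) (degree ?q) (companion u)))"
      by (intro polyfun_det_matpoly polyfun_const polyfun_companion)
    ultimately show "(\<lambda>Z :: complex ^ 'n::{finite,linorder}. \<Sum>m\<le>CARD('n). T ^ m * esym (CARD('n) - m) (\<chi> i. poly p (Z $ i))) \<in> M"
      unfolding M_def by blast
  qed
  from this[of "CARD('n) - k"] show thesis
    using assms that unfolding M_def by auto
qed

text \<open>For fixed \<open>i\<close> the product over \<open>j\<close> is a polynomial in
  \<open>Z $ i\<close> with coefficients \<open>(-1)^m * cnj (esym m Z)\<close>. The product over
  \<open>i\<close> of its values is then a determinant in the companion matrix.\<close>

lemma prod_one_minus_eq_polyfun_symmetrization: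
  obtains N where "polyfun coords_cnj N"
    "\<And>Z :: complex ^ 'n::{finite,linorder}.
       N (symmetrization Z) = (\<Prod>i\<in>UNIV. \<Prod>j\<in>UNIV. 1 - Z $ i * cnj (Z $ j))"
proof -
  \<comment> \<open>The constant coefficient 1 is not a coordinate of \<open>v\<close>, hence the
    case distinction. For \<open>m > n\<close> the term \<open>v $ (inv index m)\<close> is still
    some coordinate, so \<open>a m\<close> is polynomial for every \<open>m\<close>.\<close>
  define a :: "nat \<Rightarrow> complex ^ 'n::{finite,linorder} \<Rightarrow> complex" where
    "a = (\<lambda>m v. if m = 0 then 1 else (-1) ^ m * cnj (v $ (inv index m)))"
  have a_symm: "a m (symmetrization Z) = (-1) ^ m * cnj (esym m Z)" if m: "m \<le> CARD('n)" for m and Z :: "complex ^ 'n::{finite,linorder}"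
  proof (cases "m = 0")
    case False
    then obtain i :: 'n where "index i = m" using index_surj[of m] m by auto
    then show ?thesis using False by (auto simp: a_def symmetrization_nth inv_f_f[OF inj_index])
  qed (simp add: a_def esym_0)
  have eq: "det (matpoly (\<lambda>m. a m (symmetrization Z)) CARD('n) (companion (symmetrization Z))) =
      (\<Prod>i\<in>UNIV. \<Prod>j\<in>UNIV. 1 - Z $ i * cnj (Z $ j))" for Z :: "complex ^ 'n::{finite,linorder}"
    unfolding det_matpoly_companion
  proof (rule prod.cong[OF refl])
    fix i
    let ?t = "Z $ i"
    have "(\<Prod>j\<in>UNIV. 1 - ?t * cnj (Z $ j)) = poly (\<Prod>j\<in>UNIV. [:(\<chi> j. (- ?t) * (\<chi> j. cnj (Z $ j)) $ j) $ j, 1:]) 1"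
      by (simp add: poly_prod)
    also have "\<dots> = (\<Sum>m\<le>CARD('n). (- ?t) ^ m * cnj (esym m Z))"
      unfolding prod_linear_factors_esym esym_scale cnj_esym by (simp add: poly_sum)
    also have "\<dots> = (\<Sum>m\<le>CARD('n). a m (symmetrization Z) * ?t ^ m)"
      by (rule sum.cong) (auto simp: a_symm power_minus[of ?t])
    finally show "(\<Sum>m\<le>CARD('n). a m (symmetrization Z) * ?t ^ m) = (\<Prod>j\<in>UNIV. 1 - ?t * cnj (Z $ j))" by simp
  qed
  have "polyfun coords_cnj (a m)" for m
  proof (cases "m = 0")
    case False
    have "polyfun coords_cnj (\<lambda>v :: complex ^ 'n::{finite,linorder}. (-1) ^ m * cnj (v $ (inv index m)))"
      by (intro polyfun_mult polyfun_const polyfun_base) (simp add: coords_cnj_def)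
    then show ?thesis using False by (simp add: a_def)
  qed (simp add: a_def polyfun_const)
  then have "polyfun coords_cnj (\<lambda>u. det (matpoly (\<lambda>m. a m u) CARD('n) (companion u)))"
    by (intro polyfun_det_matpoly polyfun_mono[OF polyfun_companion]) (auto simp: coords_cnj_def)
  then show thesis using eq that by blast
qed

subsection \<open>Derivative of the induced map\<close>

text \<open>Newton interpolation by divided differences, one node at a time. Nodes may repeat
  because each difference quotient extends holomorphically over its node.\<close>

lemma holomorphic_interpolation:
  assumes "f holomorphic_on S" "open S" "set as \<subseteq> S"
  shows "\<exists>p g. g holomorphic_on S \<and> (\<forall>t\<in>S. f t = poly p t + (\<Prod>a\<leftarrow>as. t - a) * g t)"
  using assms(1,3)
proof (induction as arbitrary: f)
  case Nil
  then show ?case by (intro exI[of _ 0] exI[of _ f]) auto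
next
  case (Cons a as)
  define f1 where "f1 = (\<lambda>z. if z = a then deriv f a else (f z - f a) / (z - a))"
  have "f1 holomorphic_on S"
    unfolding f1_def by (rule pole_lemma_open[OF Cons.prems(1) assms(2)])
  then obtain p g where pg: "g holomorphic_on S" "\<forall>t\<in>S. f1 t = poly p t + (\<Prod>a\<leftarrow>as. t - a) * g t"
    using Cons.IH Cons.prems(2) by (metis set_subset_Cons subset_trans)
  have "f t = poly ([:f a:] + [:-a, 1:] * p) t + (\<Prod>a\<leftarrow>a # as. t - a) * g t" if "t \<in> S" for t
  proof -
    have "f t = f a + (t - a) * f1 t" by (simp add: f1_def)
    also have "\<dots> = f a + (t - a) * (poly p t + (\<Prod>a\<leftarrow>as. t - a) * g t)" using pg(2) that by simp
    finally show ?thesis by (simp add: algebra_simps)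
  qed
  with pg(1) show ?case by blast
qed

lemma esym_lipschitz:
  fixes a b :: "complex ^ 'n"
  assumes "M \<ge> 1" "\<And>i. norm (a $ i) \<le> M" "\<And>i. norm (b $ i) \<le> M"
  shows "norm (esym k a - esym k b) \<le> card {I :: 'n set. card I = k} * (M ^ CARD('n) * (\<Sum>i\<in>UNIV. norm (a $ i - b $ i)))"
proof -
  have *: "norm ((\<Prod>i\<in>I. a $ i) - (\<Prod>i\<in>I. b $ i)) \<le> M ^ CARD('n) * (\<Sum>i\<in>UNIV. norm (a $ i - b $ i))" for I
  proof -
    \<comment> \<open>The bound for differences of products concerns factors of norm at most 1,
      hence the rescaling by \<open>M\<close>.\<close>
    have "(\<Prod>i\<in>I. c $ i) = of_real M ^ card I * (\<Prod>i\<in>I. c $ i / of_real M)" for c :: "complex ^ 'n"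
      using assms(1) by (simp add: prod_dividef)
    then have "norm ((\<Prod>i\<in>I. a $ i) - (\<Prod>i\<in>I. b $ i)) =
        M ^ card I * norm ((\<Prod>i\<in>I. a $ i / of_real M) - (\<Prod>i\<in>I. b $ i / of_real M))"
      using assms(1) by (simp add: right_diff_distrib[symmetric] norm_mult norm_power)
    also have "\<dots> \<le> M ^ CARD('n) * (\<Sum>i\<in>UNIV. norm (a $ i - b $ i))"
    proof (rule mult_mono)
      show "M ^ card I \<le> M ^ CARD('n)"
        using assms(1) by (intro power_increasing card_mono) auto
      have "norm ((\<Prod>i\<in>I. a $ i / of_real M) - (\<Prod>i\<in>I. b $ i / of_real M)) \<le>
          (\<Sum>i\<in>I. norm (a $ i / of_real M - b $ i / of_real M))"
        using assms by (intro norm_prod_diff) (auto simp: norm_divide field_simps)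
      also have "\<dots> \<le> (\<Sum>i\<in>I. norm (a $ i - b $ i))"
      proof (rule sum_mono)
        fix i
        have "norm (a $ i / of_real M - b $ i / of_real M) = norm (a $ i - b $ i) / M"
          using assms(1) by (simp add: diff_divide_distrib[symmetric] norm_divide)
        also have "\<dots> \<le> norm (a $ i - b $ i) / 1" using assms(1) by (intro divide_left_mono) auto
        finally show "norm (a $ i / of_real M - b $ i / of_real M) \<le> norm (a $ i - b $ i)" by simp
      qed
      also have "\<dots> \<le> (\<Sum>i\<in>UNIV. norm (a $ i - b $ i))" by (rule sum_mono2) auto
      finally show "norm ((\<Prod>i\<in>I. a $ i / of_real M) - (\<Prod>i\<in>I. b $ i / of_real M)) \<le> (\<Sum>i\<in>UNIV. norm (a $ i - b $ i))" .
    qed (use assms(1) in auto)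
    finally show ?thesis .
  qed
  have "norm (esym k a - esym k b) \<le> (\<Sum>I | card I = k. norm ((\<Prod>i\<in>I. a $ i) - (\<Prod>i\<in>I. b $ i)))"
    unfolding esym_def sum_subtractf[symmetric] by (rule norm_sum)
  also have "\<dots> \<le> (\<Sum>I | card (I :: 'n set) = k. M ^ CARD('n) * (\<Sum>i\<in>UNIV. norm (a $ i - b $ i)))"
    by (rule sum_mono) (rule *)
  finally show ?thesis by simp
qed

lemma has_wirtinger_perturb:
  fixes f g :: "complex ^ 'n \<Rightarrow> complex"
  assumes g: "has_wirtinger g a b x" and "\<delta> > 0"
    and close: "\<And>y. dist y x < \<delta> \<Longrightarrow> norm (f y - g y) \<le> C * (norm (y - x))\<^sup>2"
  shows "has_wirtinger f a b x"
proof -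
  have "((\<lambda>y. f y - g y) has_derivative (\<lambda>t. 0)) (at x)"
  proof (rule has_derivativeI_sandwich[OF \<open>\<delta> > 0\<close>, where H = "\<lambda>y. C * norm (y - x)"])
    \<comment> \<open>At \<open>y = x\<close> the quadratic bound is 0, so the two functions agree
      there.\<close>
    have "f x - g x = 0" using close[of x] \<open>\<delta> > 0\<close> by simp
    then show "norm ((f y - g y) - (f x - g x) - 0) / norm (y - x) \<le> C * norm (y - x)"
      if "y \<noteq> x" "dist y x < \<delta>" for y
      using close[OF that(2)] that(1) by (simp add: power2_eq_square divide_le_eq mult.assoc)
    have "((\<lambda>y. C * norm (y - x)) \<longlongrightarrow> C * norm (x - x)) (at x)" by (intro tendsto_intros)
    then show "((\<lambda>y. C * norm (y - x)) \<longlongrightarrow> 0) (at x)" by simp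
  qed auto
  from has_derivative_add[OF g[unfolded has_wirtinger_def] this] show ?thesis
    by (simp add: has_wirtinger_def)
qed

lemma induced_map_has_wirtinger:
  fixes Z :: "complex ^ 'n::{finite,linorder}"
  assumes Z: "Z \<in> polydisc" and f: "f holomorphic_on ball 0 1" "f ` ball 0 1 \<subseteq> ball 0 1"
  obtains J where "\<And>k. has_wirtinger (\<lambda>u. induced_map f u $ k) (J k) (\<lambda>i. 0) (symmetrization Z)"
proof -
  have "\<exists>a. has_wirtinger (\<lambda>u. induced_map f u $ k) a (\<lambda>i. 0) (symmetrization Z)" for k
  proof -
    obtain \<rho> where \<rho>: "0 < \<rho>" "\<rho> < 1" "\<And>i. norm (Z $ i) < \<rho>"
      using polydisc_radius[OF Z] by blast
    obtain \<delta> where \<delta>: "\<delta> > 0"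
      "\<And>W i. dist (symmetrization W) (symmetrization Z) < \<delta> \<Longrightarrow> norm (W $ i) < \<rho>"
      using roots_in_disc_stable[of Z \<rho>] \<rho> by auto
    define q where "q = poly (vieta (symmetrization Z))"
    obtain xs where xs: "mset xs = mset_set (UNIV :: 'n set)" using ex_mset by blast
    \<comment> \<open>Listing every coordinate twice makes the node product the square of
      \<open>q\<close>, which yields the quadratic error.\<close>
    have q_eq: "(\<Prod>a\<leftarrow>map (($) Z) xs @ map (($) Z) xs. t - a) = (q t)\<^sup>2" for t
    proof -
      have "prod_list (map (\<lambda>i. t - Z $ i) xs) = prod_mset (image_mset (\<lambda>i. t - Z $ i) (mset xs))"
        by (metis mset_map prod_mset_prod_list)
      then show ?thesis
        by (simp add: o_def q_def poly_vieta_symmetrization xs prod_unfold_prod_mset power2_eq_square)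
    qed
    have "set (map (($) Z) xs @ map (($) Z) xs) \<subseteq> ball 0 1" using Z by (auto simp: polydisc_def)
    from holomorphic_interpolation[OF f(1) open_ball this, unfolded q_eq]
    obtain p g where g: "g holomorphic_on ball 0 1"
      and fpg: "\<And>t. t \<in> ball 0 1 \<Longrightarrow> f t = poly p t + (q t)\<^sup>2 * g t" by blast
    have sub: "cball 0 \<rho> \<subseteq> ball (0::complex) 1" using \<rho> by auto
    have "bounded (g ` cball 0 \<rho>)"
      using holomorphic_on_imp_continuous_on[OF holomorphic_on_subset[OF g sub]]
      by (intro compact_imp_bounded compact_continuous_image) auto
    then obtain B where B: "B > 0" "\<And>t. norm t \<le> \<rho> \<Longrightarrow> norm (g t) \<le> B"
      by (auto simp: bounded_pos)
    have "bounded (poly p ` cball 0 \<rho>)"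
      by (intro compact_imp_bounded compact_continuous_image continuous_intros) auto
    then obtain M0 where M0: "M0 > 0" "\<And>t. norm t \<le> \<rho> \<Longrightarrow> norm (poly p t) \<le> M0"
      by (auto simp: bounded_pos)
    \<comment> \<open>A common bound for \<open>p\<close> on the smaller disc and for
      \<open>f\<close>, whose values have norm below 1.\<close>
    define M where "M = max 1 M0"
    obtain P where P: "polyfun coords P" "\<And>W :: complex ^ 'n::{finite,linorder}. esym (index k) (\<chi> i. poly p (W $ i)) = P (symmetrization W)"
      using esym_poly_eq_polyfun_symmetrization[OF index_le_card] by metis
    obtain a where a: "has_wirtinger P a (\<lambda>i. 0) (symmetrization Z)"
      using polyfun_coords_wirtinger[OF P(1)] by blast
    define N where "N = real CARD('n)"
    define K where "K = card {I :: 'n set. card I = index k} * M ^ CARD('n)"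
    have "norm (induced_map f u $ k - P u) \<le> (K * N * N\<^sup>2 * B) * (norm (u - symmetrization Z))\<^sup>2"
      if u: "dist u (symmetrization Z) < \<delta>" for u
    proof -
      obtain W where W: "symmetrization W = u" by (rule surj_symmetrization)
      have W\<rho>: "norm (W $ i) < \<rho>" for i using \<delta>(2)[of W i] u W by simp
      then have W1: "W $ i \<in> ball 0 1" for i using order.strict_trans[OF W\<rho> \<rho>(2)] by simp
      then have Wp: "W \<in> polydisc" by (simp add: polydisc_def)
      have diff: "norm (f (W $ i) - poly p (W $ i)) \<le> (norm (u - symmetrization Z) * N)\<^sup>2 * B" for i
      proof -
        have "poly (vieta u) (W $ i) = 0"
          by (auto simp: W[symmetric] poly_vieta_symmetrization prod_zero_iff)
        then have "norm (q (W $ i)) \<le> norm (u - symmetrization Z) * (\<Sum>k\<in>(UNIV :: 'n set). norm (W $ i) ^ (CARD('n) - index k))"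
          using norm_poly_vieta_diff[of u "W $ i" "symmetrization Z"] by (simp add: q_def)
        \<comment> \<open>The roots \<open>W $ i\<close> lie in the unit disc, so all their powers
          have norm at most 1.\<close>
        also have "\<dots> \<le> norm (u - symmetrization Z) * (\<Sum>k\<in>(UNIV :: 'n set). 1)"
          using W1[of i] by (intro mult_left_mono sum_mono power_le_one) auto
        finally have "norm (q (W $ i)) \<le> norm (u - symmetrization Z) * N" by (simp add: N_def)
        then show ?thesis
          using fpg[OF W1[of i]] B(2)[OF less_imp_le[OF W\<rho>[of i]]]
          by (simp add: norm_mult norm_power) (intro mult_mono power_mono, auto)
      qed
      have "norm (induced_map f u $ k - P u) =
          norm (esym (index k) (\<chi> i. f (W $ i)) - esym (index k) (\<chi> i. poly p (W $ i)))"
        unfolding P(2) W[symmetric] induced_map_symmetrization[OF Wp] symmetrization_nth ..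
      also have "\<dots> \<le> card {I :: 'n set. card I = index k} * (M ^ CARD('n) *
          (\<Sum>i\<in>UNIV. norm ((\<chi> i. f (W $ i)) $ i - (\<chi> i. poly p (W $ i)) $ i)))"
      proof (rule esym_lipschitz)
        show "1 \<le> M" by (simp add: M_def)
        show "norm ((\<chi> i. f (W $ i)) $ i) \<le> M" for i
        proof -
          have "norm (f (W $ i)) < 1" using f(2) W1[of i] by (simp add: image_subset_iff)
          then show ?thesis by (simp add: M_def)
        qed
        show "norm ((\<chi> i. poly p (W $ i)) $ i) \<le> M" for i
          using M0(2)[OF less_imp_le[OF W\<rho>[of i]]] by (simp add: M_def)
      qed
      also have "\<dots> = K * (\<Sum>i\<in>UNIV. norm (f (W $ i) - poly p (W $ i)))"
        by (simp add: K_def)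
      also have "\<dots> \<le> K * (\<Sum>i\<in>(UNIV :: 'n set). (norm (u - symmetrization Z) * N)\<^sup>2 * B)"
        by (intro mult_left_mono sum_mono diff) (simp add: K_def M_def)
      also have "\<dots> = (K * N * N\<^sup>2 * B) * (norm (u - symmetrization Z))\<^sup>2"
        by (simp add: N_def power_mult_distrib)
      finally show ?thesis .
    qed
    from has_wirtinger_perturb[OF a \<delta>(1) this] show ?thesis by blast
  qed
  then show thesis using that by metis
qed

subsection \<open>The pulled-back metric\<close>

text \<open>Positive real part keeps each factor of the reciprocal kernel nonzero and off the branch
  cut of the principal logarithm.\<close>

lemma polydisc_one_minus:
  assumes "W \<in> polydisc" "Z \<in> polydisc"
  shows "Re (1 - W $ i * cnj (Z $ j)) > 0"
proof -
  have "norm (W $ i) < 1" "norm (Z $ j) < 1" using assms by (auto simp: polydisc_def)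
  then have "norm (W $ i) * norm (Z $ j) < 1"
    using mult_left_le[of "norm (Z $ j)" "norm (W $ i)"] by simp
  then have "norm (W $ i * cnj (Z $ j)) < 1" by (simp add: norm_mult)
  moreover have "Re (W $ i * cnj (Z $ j)) \<le> norm (W $ i * cnj (Z $ j))" by (rule complex_Re_le_cmod)
  ultimately show ?thesis by simp
qed

lemma open_polydisc: "open (polydisc :: (complex ^ 'n) set)"
  unfolding polydisc_def by (intro open_vector_box allI open_ball)

text \<open>Conjugation exchanges the terms for \<open>(i, j)\<close> and \<open>(j, i)\<close>, so
  the sum of logarithms is real. This excludes an additive multiple of \<open>2 * pi * \<i>\<close>
  between it and the principal logarithm of the product.\<close>

lemma polydisc_prod_eq_exp:
  fixes Z :: "complex ^ 'n"
  assumes "Z \<in> polydisc"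
  defines "L \<equiv> (\<Sum>i\<in>UNIV. \<Sum>j\<in>UNIV. Ln (1 - Z $ i * cnj (Z $ j)))"
  shows "(\<Prod>i\<in>UNIV. \<Prod>j\<in>UNIV. 1 - Z $ i * cnj (Z $ j)) = exp L" "L \<in> \<real>"
proof -
  have pos: "Re (1 - Z $ i * cnj (Z $ j)) > 0" for i j
    using polydisc_one_minus[OF assms(1,1)] .
  then have nz: "1 - Z $ i * cnj (Z $ j) \<noteq> 0" for i j
    by (metis less_irrefl zero_complex.sel(1))
  then show "(\<Prod>i\<in>UNIV. \<Prod>j\<in>UNIV. 1 - Z $ i * cnj (Z $ j)) = exp L"
    unfolding L_def by (simp add: exp_sum)
  have "cnj (Ln (1 - Z $ i * cnj (Z $ j))) = Ln (1 - Z $ j * cnj (Z $ i))" for i j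
  proof -
    have "1 - Z $ i * cnj (Z $ j) \<notin> \<real>\<^sub>\<le>\<^sub>0"
      using pos[of i j] by (auto simp: complex_nonpos_Reals_iff)
    then have "cnj (Ln (1 - Z $ i * cnj (Z $ j))) = Ln (cnj (1 - Z $ i * cnj (Z $ j)))"
      by (rule cnj_Ln)
    then show ?thesis by (simp add: mult.commute)
  qed
  then have "cnj L = (\<Sum>i\<in>UNIV. \<Sum>j\<in>UNIV. Ln (1 - Z $ j * cnj (Z $ i)))"
    by (simp add: L_def)
  also have "\<dots> = L" unfolding L_def by (rule sum.swap)
  finally show "L \<in> \<real>" by (simp add: Reals_cnj_iff)
qed

lemma conjugate_transpose_mult:
  "conjugate_transpose (A ** B) = conjugate_transpose B ** conjugate_transpose A"
  by (simp add: conjugate_transpose_def map_matrix_def transpose_def matrix_matrix_mult_def vec_eq_iff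
      cnj_sum mult.commute)

text \<open>The sums are nested as the chain rule produces them: conjugate derivative outside,
  holomorphic derivative inside.\<close>

lemma conjugate_transpose_sandwich:
  fixes A :: "complex ^ 'n ^ 'm"
  shows "(conjugate_transpose A ** G ** A) $ i $ j =
    (\<Sum>\<alpha>\<in>UNIV. (\<Sum>\<beta>\<in>UNIV. G $ \<alpha> $ \<beta> * A $ \<beta> $ j) * cnj (A $ \<alpha> $ i))"
  unfolding matrix_mul_assoc[symmetric]
  by (simp add: conjugate_transpose_def map_matrix_def transpose_def matrix_matrix_mult_def mult.commute)

lemma symmetrization_derivative:
  obtains c :: "'n::{finite,linorder} \<Rightarrow> 'n::{finite,linorder} \<Rightarrow> complex ^ 'n::{finite,linorder} \<Rightarrow> complex"
  where "\<And>k x. has_wirtinger (\<lambda>z. symmetrization z $ k) (\<lambda>i. c k i x) (\<lambda>i. 0) x"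
    "\<And>k i. polyfun coords (c k i)"
proof -
  have "\<exists>a. (\<forall>i. polyfun coords (a i)) \<and>
      (\<forall>x. has_wirtinger (\<lambda>z :: complex ^ 'n::{finite,linorder}. symmetrization z $ k) (\<lambda>i. a i x) (\<lambda>i. 0) x)" for k
    unfolding symmetrization_nth by (rule polyfun_coords_wirtinger[OF polyfun_esym])
  then show thesis using that by metis
qed

text \<open>Supplies the regularity for two uses of the chain rule: first order near the point, then
  the conjugate derivatives at the point itself. It rests on \<open>h = - Ln N\<close> with the
  polynomial \<open>N\<close>.\<close>

lemma szego_kernel_log_smooth:
  fixes Z :: "complex ^ 'n::{finite,linorder}"
  assumes "Z \<in> polydisc"
  defines "h \<equiv> \<lambda>v :: complex ^ 'n::{finite,linorder}. ln (szego_kernel v v)"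
  obtains U where "open U" "symmetrization Z \<in> U" "\<And>v. v \<in> U \<Longrightarrow> h differentiable (at v)"
    "\<And>k. wirtinger_bar k h differentiable (at (symmetrization Z))"
    "\<And>W. symmetrization W \<in> U \<Longrightarrow> W \<in> polydisc"
proof -
  obtain \<delta> where \<delta>: "\<delta> > 0" "\<And>W. symmetrization W \<in> ball (symmetrization Z) \<delta> \<Longrightarrow> W \<in> polydisc"
    using symmetrized_polydisc_nhd[OF assms(1)] by blast
  define U where "U = ball (symmetrization Z) \<delta>"
  have U: "open U" "symmetrization Z \<in> U" using \<delta>(1) by (auto simp: U_def)
  obtain N where N: "polyfun coords_cnj N" "\<And>W :: complex ^ 'n::{finite,linorder}.
       N (symmetrization W) = (\<Prod>i\<in>UNIV. \<Prod>j\<in>UNIV. 1 - W $ i * cnj (W $ j))"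
    by (rule prod_one_minus_eq_polyfun_symmetrization) blast
  obtain a b where ab: "\<And>k. polyfun coords_cnj (b k)" "\<And>x. has_wirtinger N (\<lambda>k. a k x) (\<lambda>k. b k x) x"
    using polyfun_coords_cnj_wirtinger[OF N(1)] by blast
  \<comment> \<open>On \<open>U\<close> every point is the symmetrization of a polydisc point, so
    \<open>N\<close> is a positive real there and the logarithm of its reciprocal is
    \<open>- Ln N\<close>.\<close>
  have N_pos: "\<exists>r. N v = of_real (exp r) \<and> h v = - Ln (N v)" if "v \<in> U" for v
  proof -
    obtain W where W: "symmetrization W = v" by (rule surj_symmetrization)
    then have Wp: "W \<in> polydisc" using \<delta>(2) that by (auto simp: U_def)
    then obtain r where r: "N v = exp (of_real r)"
      using polydisc_prod_eq_exp[OF Wp] N(2)[of W] W by (auto elim!: Reals_cases)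
    have "szego_kernel v v = inverse (N v)"
      unfolding W[symmetric] szego_kernel_symmetrization[OF Wp Wp] N(2)
      by (simp add: prod_dividef inverse_eq_divide)
    also have "\<dots> = exp (of_real (- r))" by (simp add: r exp_minus)
    finally have "h v = of_real (- r)" unfolding h_def by simp
    moreover have "Ln (N v) = of_real r" by (simp add: r)
    ultimately show ?thesis using r by (auto simp: exp_of_real)
  qed
  have N_dom: "N v \<notin> \<real>\<^sub>\<le>\<^sub>0" if "v \<in> U" for v
    using N_pos[OF that] by (auto simp: complex_nonpos_Reals_iff)
  have hw: "has_wirtinger h (\<lambda>k. - inverse (N v) * a k v) (\<lambda>k. - inverse (N v) * b k v) v" if "v \<in> U" for v
  proof (rule has_wirtinger_transform[OF _ U(1) that])
    have "((\<lambda>t. - Ln t) has_field_derivative - inverse (N v)) (at (N v))"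
      by (intro derivative_intros has_field_derivative_Ln N_dom[OF that])
    from has_wirtinger_DERIV[OF ab(2) this]
    show "has_wirtinger (\<lambda>v. - Ln (N v)) (\<lambda>k. - inverse (N v) * a k v) (\<lambda>k. - inverse (N v) * b k v) v" .
  qed (use N_pos in auto)
  have "wirtinger_bar k h differentiable (at (symmetrization Z))" for k
  proof -
    let ?u = "symmetrization Z"
    obtain a' b' where b': "has_wirtinger (b k) a' b' ?u"
      using polyfun_coords_cnj_wirtinger[OF ab(1)] by blast
    have "((\<lambda>t. - inverse t) has_field_derivative - (- (inverse (N ?u) * 1 * inverse (N ?u)))) (at (N ?u))"
      using N_dom[OF U(2)] by (intro derivative_intros) auto
    from has_wirtinger_mult[OF has_wirtinger_DERIV[OF ab(2) this] b']
    have "\<exists>c d. has_wirtinger (\<lambda>v. - inverse (N v) * b k v) c d ?u" by blast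
    then obtain c d where cd: "has_wirtinger (\<lambda>v. - inverse (N v) * b k v) c d ?u" by blast
    have "has_wirtinger (wirtinger_bar k h) c d ?u"
      by (rule has_wirtinger_transform[OF cd U]) (rule has_wirtinger_imp_wirtinger(2)[OF hw, symmetric])
    then show ?thesis using has_wirtinger_imp_differentiable by blast
  qed
  then show thesis
    using that[OF U] has_wirtinger_imp_differentiable[OF hw] \<delta>(2) by (auto simp: U_def)
qed

lemma pullback_szego_metric:
  fixes Z :: "complex ^ 'n::{finite,linorder}"
  assumes Z: "Z \<in> polydisc"
  shows "pullback_form symmetrization szego_metric Z = (\<chi> i j. 1 / (1 - cnj (Z $ i) * Z $ j)\<^sup>2)"
proof -
  define h where "h = (\<lambda>v :: complex ^ 'n::{finite,linorder}. ln (szego_kernel v v))"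
  obtain U where U: "open U" "symmetrization Z \<in> U" "\<And>v. v \<in> U \<Longrightarrow> h differentiable (at v)"
    "\<And>k. wirtinger_bar k h differentiable (at (symmetrization Z))"
    "\<And>W. symmetrization W \<in> U \<Longrightarrow> W \<in> polydisc"
    using szego_kernel_log_smooth[OF Z] unfolding h_def by blast
  obtain c :: "'n \<Rightarrow> 'n \<Rightarrow> complex ^ 'n::{finite,linorder} \<Rightarrow> complex" where
    c: "\<And>k x. has_wirtinger (\<lambda>z. symmetrization z $ k) (\<lambda>i. c k i x) (\<lambda>i. 0) x"
       "\<And>k i. polyfun coords (c k i)"
    by (rule symmetrization_derivative) blast
  define V where "V = symmetrization -` U"
  have V: "open V" "Z \<in> V" "V \<subseteq> polydisc"
    using open_vimage[OF U(1) continuous_on_symmetrization] U(2,5) by (auto simp: V_def)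
  \<comment> \<open>The derivative of \<open>h\<close> after \<open>symmetrization\<close> by the
    conjugate of \<open>z $ i\<close>, by the chain rule on the left and from the explicit
    logarithms on the right. It holds on the open set \<open>V\<close>, so it can be differentiated
    again.\<close>
  have first: "(\<Sum>\<alpha>\<in>UNIV. wirtinger_bar \<alpha> h (symmetrization z) * cnj (c \<alpha> i z)) =
      (\<Sum>k\<in>UNIV. z $ k * inverse (1 - z $ k * cnj (z $ i)))" if z: "z \<in> V" for i z
  proof -
    have zp: "z \<in> polydisc" using z V(3) by blast
    have 1: "has_wirtinger (\<lambda>z. h (symmetrization z))
        (\<lambda>i. \<Sum>\<alpha>\<in>UNIV. wirtinger \<alpha> h (symmetrization z) * c \<alpha> i z)
        (\<lambda>i. \<Sum>\<alpha>\<in>UNIV. wirtinger_bar \<alpha> h (symmetrization z) * cnj (c \<alpha> i z)) z"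
      using z by (intro has_wirtinger_compose has_wirtinger_if_differentiable U(3) c(1)) (simp add: V_def)
    have log: "has_wirtinger (\<lambda>z. - Ln (1 + (- 1) * (z $ k * cnj (z $ l))))
        (\<lambda>i. - inverse (1 - z $ k * cnj (z $ l)) * ((- 1) * ((if i = k then 1 else 0) * cnj (z $ l))))
        (\<lambda>i. - inverse (1 - z $ k * cnj (z $ l)) * ((- 1) * (z $ k * (if i = l then 1 else 0)))) z" for k l
    proof -
      have "1 + (- 1) * (z $ k * cnj (z $ l)) \<notin> \<real>\<^sub>\<le>\<^sub>0"
        using polydisc_one_minus[OF zp zp, of k l] by (auto simp: complex_nonpos_Reals_iff)
      then have D: "((\<lambda>t. - Ln t) has_field_derivative - inverse (1 + (- 1) * (z $ k * cnj (z $ l))))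
          (at (1 + (- 1) * (z $ k * cnj (z $ l))))"
        by (intro derivative_intros has_field_derivative_Ln)
      show ?thesis
        by (rule has_wirtinger_eq_rhs[OF has_wirtinger_DERIV[OF has_wirtinger_add[OF has_wirtinger_const
          has_wirtinger_mult[OF has_wirtinger_const has_wirtinger_mult[OF has_wirtinger_coord
          has_wirtinger_cnj[OF has_wirtinger_coord]]]] D]]) simp_all
    qed
    have "h (symmetrization y) = (\<Sum>k\<in>UNIV. \<Sum>l\<in>UNIV. - Ln (1 + (- 1) * (y $ k * cnj (y $ l))))" if "y \<in> V" for y
    proof -
      have yp: "y \<in> polydisc" using that V(3) by blast
      obtain r where r: "(\<Sum>k\<in>UNIV. \<Sum>l\<in>UNIV. Ln (1 - y $ k * cnj (y $ l))) = of_real r"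
        using polydisc_prod_eq_exp(2)[OF yp] by (auto elim!: Reals_cases)
      have "szego_kernel (symmetrization y) (symmetrization y) = inverse (exp (of_real r))"
        unfolding r[symmetric] polydisc_prod_eq_exp(1)[OF yp, symmetric] szego_kernel_symmetrization[OF yp yp]
        by (simp add: prod_dividef inverse_eq_divide)
      also have "\<dots> = exp (of_real (- r))" by (simp add: exp_minus)
      finally have "h (symmetrization y) = - of_real r" unfolding h_def by simp
      then show ?thesis unfolding r[symmetric] by (simp add: sum_negf)
    qed
    note transformed = has_wirtinger_transform[OF 1 V(1) z this]
    have "has_wirtinger (\<lambda>z. \<Sum>k\<in>UNIV. \<Sum>l\<in>UNIV. - Ln (1 + (- 1) * (z $ k * cnj (z $ l))))
        (\<lambda>i. \<Sum>k\<in>UNIV. \<Sum>l\<in>UNIV. - inverse (1 - z $ k * cnj (z $ l)) * ((- 1) * ((if i = k then 1 else 0) * cnj (z $ l))))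
        (\<lambda>i. \<Sum>k\<in>UNIV. \<Sum>l\<in>UNIV. - inverse (1 - z $ k * cnj (z $ l)) * ((- 1) * (z $ k * (if i = l then 1 else 0)))) z"
      by (intro has_wirtinger_sum log)
    then have "(\<Sum>\<alpha>\<in>UNIV. wirtinger_bar \<alpha> h (symmetrization z) * cnj (c \<alpha> i z)) =
        (\<Sum>k\<in>UNIV. \<Sum>l\<in>UNIV. - inverse (1 - z $ k * cnj (z $ l)) * ((- 1) * (z $ k * (if i = l then 1 else 0))))"
      using has_wirtinger_imp_wirtinger(2)[OF transformed] by (simp only: has_wirtinger_imp_wirtinger(2))
    also have "\<dots> = (\<Sum>k\<in>UNIV. \<Sum>l\<in>UNIV. if l = i then z $ k * inverse (1 - z $ k * cnj (z $ l)) else 0)"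
      by (intro sum.cong) auto
    finally show ?thesis by simp
  qed
  have "(\<Sum>\<alpha>\<in>UNIV. (\<Sum>\<beta>\<in>UNIV. wirtinger \<beta> (wirtinger_bar \<alpha> h) (symmetrization Z) * c \<beta> j Z) * cnj (c \<alpha> i Z)) =
      1 / (1 - cnj (Z $ i) * Z $ j)\<^sup>2" for i j
  proof -
    have "\<exists>d. has_wirtinger (c \<alpha> i) d (\<lambda>k. 0) Z" for \<alpha>
      using polyfun_coords_wirtinger[OF c(2)] by blast
    then obtain d where d: "\<And>\<alpha>. has_wirtinger (c \<alpha> i) (d \<alpha>) (\<lambda>k. 0) Z" by metis
    \<comment> \<open>The factor \<open>cnj (c \<alpha> i z)\<close> is antiholomorphic; its
      holomorphic derivative is the \<open>cnj 0\<close>. Only the second derivatives of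
      \<open>h\<close> survive.\<close>
    have "has_wirtinger (\<lambda>z. wirtinger_bar \<alpha> h (symmetrization z) * cnj (c \<alpha> i z))
        (\<lambda>j. wirtinger_bar \<alpha> h (symmetrization Z) * cnj 0 +
             (\<Sum>\<beta>\<in>UNIV. wirtinger \<beta> (wirtinger_bar \<alpha> h) (symmetrization Z) * c \<beta> j Z) * cnj (c \<alpha> i Z))
        (\<lambda>j. wirtinger_bar \<alpha> h (symmetrization Z) * cnj (d \<alpha> j) +
             (\<Sum>\<beta>\<in>UNIV. wirtinger_bar \<beta> (wirtinger_bar \<alpha> h) (symmetrization Z) * cnj (c \<beta> j Z)) * cnj (c \<alpha> i Z)) Z" for \<alpha>
      by (intro has_wirtinger_mult has_wirtinger_cnj d has_wirtinger_compose has_wirtinger_if_differentiable U(4) c(1))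
    from has_wirtinger_transform[OF has_wirtinger_sum[OF this] V(1,2) first]
    have "(\<Sum>\<alpha>\<in>UNIV. (\<Sum>\<beta>\<in>UNIV. wirtinger \<beta> (wirtinger_bar \<alpha> h) (symmetrization Z) * c \<beta> j Z) * cnj (c \<alpha> i Z)) =
        wirtinger j (\<lambda>z. \<Sum>k\<in>UNIV. z $ k * inverse (1 - z $ k * cnj (z $ i))) Z"
      by (simp add: has_wirtinger_imp_wirtinger(1))
    also have "\<dots> = (\<Sum>k\<in>UNIV. if k = j then 1 / (1 - cnj (Z $ i) * Z $ j)\<^sup>2 else 0)"
    proof -
      have nz: "1 - Z $ k * cnj (Z $ i) \<noteq> 0" for k
        using polydisc_one_minus[OF Z Z, of k i] by (metis less_irrefl zero_complex.sel(1))
      define w where "w = (\<lambda>k. 1 + (- 1) * (Z $ k * cnj (Z $ i)))"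
      have "has_wirtinger (\<lambda>z. 1 + (- 1) * (z $ k * cnj (z $ i)))
          (\<lambda>l. - (if l = k then 1 else 0) * cnj (Z $ i))
          (\<lambda>l. - (Z $ k * (if l = i then 1 else 0))) Z" for k
        by (rule has_wirtinger_eq_rhs[OF has_wirtinger_add[OF has_wirtinger_const
          has_wirtinger_mult[OF has_wirtinger_const has_wirtinger_mult[OF has_wirtinger_coord
          has_wirtinger_cnj[OF has_wirtinger_coord]]]]]) simp_all
      moreover have "(inverse has_field_derivative - (inverse (w k) ^ 2)) (at (1 + (- 1) * (Z $ k * cnj (Z $ i))))" for k
        using DERIV_inverse[of "w k" UNIV] nz[of k] by (simp add: w_def numeral_2_eq_2)
      ultimately have "has_wirtinger (\<lambda>z. inverse (1 + (- 1) * (z $ k * cnj (z $ i))))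
          (\<lambda>l. - (inverse (w k) ^ 2) * (- (if l = k then 1 else 0) * cnj (Z $ i)))
          (\<lambda>l. - (inverse (w k) ^ 2) * (- (Z $ k * (if l = i then 1 else 0)))) Z" for k
        by (rule has_wirtinger_DERIV)
      note 2 = has_wirtinger_sum[OF has_wirtinger_mult[OF has_wirtinger_coord this], where I = UNIV]
      have "wirtinger j (\<lambda>z. \<Sum>k\<in>UNIV. z $ k * inverse (1 - z $ k * cnj (z $ i))) Z =
          (\<Sum>k\<in>UNIV. Z $ k * (- (inverse (w k) ^ 2) * (- (if j = k then 1 else 0) * cnj (Z $ i))) +
             (if j = k then 1 else 0) * inverse (w k))"
        using has_wirtinger_imp_wirtinger(1)[OF 2, of j] by (simp add: w_def)
      also have "\<dots> = (\<Sum>k\<in>UNIV. if k = j then 1 / (1 - cnj (Z $ i) * Z $ j)\<^sup>2 else 0)"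
      proof (rule sum.cong[OF refl])
        fix k
        have "w j \<noteq> 0" "Z $ j * cnj (Z $ i) = 1 - w j"
          using nz[of j] by (auto simp: w_def)
        \<comment> \<open>Substituting \<open>1 - w j\<close> for the product of
          \<open>Z $ j\<close> and \<open>cnj (Z $ i)\<close> merges the two terms of the product
          rule.\<close>
        then have "Z $ j * (inverse (w j) ^ 2 * cnj (Z $ i)) + inverse (w j) = 1 / (w j)\<^sup>2"
          by (simp add: mult.left_commute[of "Z $ j"]) (simp add: field_simps power2_eq_square)
        then show "Z $ k * (- (inverse (w k) ^ 2) * (- (if j = k then 1 else 0) * cnj (Z $ i))) +
             (if j = k then 1 else 0) * inverse (w k) = (if k = j then 1 / (1 - cnj (Z $ i) * Z $ j)\<^sup>2 else 0)"
          by (auto simp: w_def mult.commute)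
      qed
      finally show ?thesis .
    qed
    finally show ?thesis by simp
  qed
  then show ?thesis
    by (simp add: vec_eq_iff pullback_form_def conjugate_transpose_sandwich
        jacobian_if_components_wirtinger[OF c(1)] szego_metric_def h_def)
qed

theorem proposition3p1:
  fixes Z :: "complex ^ 'n::{finite,linorder}"
  assumes "Z \<in> polydisc"
  shows "pullback_form symmetrization szego_metric Z =
           (\<chi> i j. 1 / (1 - cnj (Z $ i) * Z $ j)\<^sup>2) \<and>
         (\<forall>f. f holomorphic_on ball 0 1 \<longrightarrow> f ` ball 0 1 \<subseteq> ball 0 1 \<longrightarrow>
           pullback_form symmetrization (pullback_form (induced_map f) szego_metric) Z =
             (\<chi> i j. cnj (deriv f (Z $ i)) * deriv f (Z $ j) /
                      (1 - cnj (f (Z $ i)) * f (Z $ j))\<^sup>2))"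
proof (intro conjI allI impI)
  show "pullback_form symmetrization szego_metric Z = (\<chi> i j. 1 / (1 - cnj (Z $ i) * Z $ j)\<^sup>2)"
    by (rule pullback_szego_metric[OF assms])
next
  fix f :: "complex \<Rightarrow> complex"
  assume f: "f holomorphic_on ball 0 1" "f ` ball 0 1 \<subseteq> ball 0 1"
  define W :: "complex ^ 'n::{finite,linorder}" where "W = (\<chi> i. f (Z $ i))"
  \<comment> \<open>The Jacobian at \<open>Z\<close> of \<open>f\<close> applied
    coordinatewise.\<close>
  define D :: "complex ^ 'n::{finite,linorder} ^ 'n::{finite,linorder}" where
    "D = (\<chi> k i. (if i = k then deriv f (Z $ k) else 0))"
  let ?F = "induced_map f :: complex ^ 'n::{finite,linorder} \<Rightarrow> _"
  let ?J = "\<lambda>x. jacobian (symmetrization :: complex ^ 'n::{finite,linorder} \<Rightarrow> _) (at x)"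
  have W: "W \<in> polydisc" using assms f(2) by (simp add: polydisc_def W_def image_subset_iff)
  have FZ: "?F (symmetrization Z) = symmetrization W"
    unfolding W_def by (rule induced_map_symmetrization[OF assms])
  obtain c :: "'n \<Rightarrow> 'n \<Rightarrow> complex ^ 'n::{finite,linorder} \<Rightarrow> complex" where
    c: "\<And>k x. has_wirtinger (\<lambda>z. symmetrization z $ k) (\<lambda>i. c k i x) (\<lambda>i. 0) x"
    by (rule symmetrization_derivative) blast
  obtain A where A: "\<And>k. has_wirtinger (\<lambda>u. ?F u $ k) (A k) (\<lambda>i. 0) (symmetrization Z)"
    using induced_map_has_wirtinger[OF assms f] by blast
  have coordwise: "has_wirtinger (\<lambda>z. (\<chi> i. f (z $ i)) $ k) (\<lambda>i. if i = k then deriv f (Z $ k) else 0) (\<lambda>i. 0) Z" for k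
  proof -
    have "(f has_field_derivative deriv f (Z $ k)) (at (Z $ k))"
      using assms by (intro holomorphic_derivI[OF f(1)]) (auto simp: polydisc_def)
    from has_wirtinger_DERIV[OF has_wirtinger_coord this] show ?thesis
      by (simp add: if_distrib[where f = "(*) _"] cong: if_cong)
  qed
  \<comment> \<open>Both sides are the Jacobian of the coordinatewise \<open>f\<close> followed by
    \<open>symmetrization\<close>. The identity relates the Jacobians without inverting
    \<open>?J Z\<close>, which is singular when coordinates of \<open>Z\<close> coincide.\<close>
  have chain: "jacobian ?F (at (symmetrization Z)) ** ?J Z = ?J W ** D"
  proof -
    have "(\<Sum>l\<in>UNIV. A k l * c l i Z) = (\<Sum>l\<in>UNIV. c k l W * (if i = l then deriv f (Z $ l) else 0))" for k i
    proof -
      have "has_wirtinger (\<lambda>z. symmetrization (\<chi> i. f (z $ i)) $ k)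
          (\<lambda>i. \<Sum>l\<in>UNIV. c k l W * (if i = l then deriv f (Z $ l) else 0)) (\<lambda>i. \<Sum>l\<in>UNIV. 0 * cnj (if i = l then deriv f (Z $ l) else 0)) Z"
        by (rule has_wirtinger_compose[OF _ coordwise]) (simp add: c W_def[symmetric])
      moreover have "has_wirtinger (\<lambda>z. ?F (symmetrization z) $ k) (\<lambda>i. \<Sum>l\<in>UNIV. A k l * c l i Z) (\<lambda>i. \<Sum>l\<in>UNIV. 0 * cnj (c l i Z)) Z"
        by (rule has_wirtinger_compose[OF A c])
      then have "has_wirtinger (\<lambda>z. symmetrization (\<chi> i. f (z $ i)) $ k) (\<lambda>i. \<Sum>l\<in>UNIV. A k l * c l i Z) (\<lambda>i. \<Sum>l\<in>UNIV. 0 * cnj (c l i Z)) Z"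
        by (rule has_wirtinger_transform[OF _ open_polydisc assms]) (simp add: induced_map_symmetrization)
      ultimately show ?thesis using has_wirtinger_imp_wirtinger(1) by (metis (no_types, lifting))
    qed
    then show ?thesis
      by (simp add: vec_eq_iff jacobian_if_components_wirtinger[OF A] jacobian_if_components_wirtinger[OF c]
          D_def matrix_matrix_mult_def)
  qed
  have "pullback_form symmetrization (pullback_form ?F szego_metric) Z =
      conjugate_transpose (?J W ** D) ** szego_metric (symmetrization W) ** (?J W ** D)"
    unfolding chain[symmetric] by (simp add: pullback_form_def FZ matrix_mul_assoc conjugate_transpose_mult)
  \<comment> \<open>Regrouping exposes the pullback at \<open>W\<close>, to which the first formula
    applies; the diagonal \<open>D\<close> then only scales rows and columns.\<close>
  also have "\<dots> = conjugate_transpose D ** pullback_form symmetrization szego_metric W ** D"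
    by (simp add: pullback_form_def matrix_mul_assoc conjugate_transpose_mult)
  also have "\<dots> = (\<chi> i j. cnj (deriv f (Z $ i)) * deriv f (Z $ j) / (1 - cnj (f (Z $ i)) * f (Z $ j))\<^sup>2)"
    unfolding pullback_szego_metric[OF W]
    by (simp add: vec_eq_iff conjugate_transpose_sandwich D_def W_def if_distrib[where f = cnj]
        if_distrib[where f = "(*) _"] cong: if_cong)
  finally show "pullback_form symmetrization (pullback_form ?F szego_metric) Z =
      (\<chi> i j. cnj (deriv f (Z $ i)) * deriv f (Z $ j) / (1 - cnj (f (Z $ i)) * f (Z $ j))\<^sup>2)" .
qed

end
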